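(* Let $k\ge 3$. There are infinitely many positive integers $n$ divisible by $k$ for which there exists a tournament on $n$ players with $H=K_k$ having exactly $\left\lfloor\frac{n}{k(k-1)}\right\rfloor$ rounds that cannot be extended.
   Context: A $K_k$-factor of $K_n$ is a partition of the $n$ vertices into $n/k$ sets of size $k$, each spanning a complete graph. A tournament with $r$ rounds on $n$ players with $H=K_k$ is a tuple $(H_1,\dots,H_r)$ of $K_k$-factors of $K_n$ such that each edge of $K_n$ lies in at most one $H_i$. Its feasibility graph is $G=K_n\setminus\bigcup_{i\le r}H_i$; the tournament can be extended if $G$ contains a $K_k$-factor. *)

theory Defs
  imports "HOL-Library.Disjoint_Sets" "HOL-Library.Ramsey"
begin

text \<open>
  A simple graph on a vertex set \<open>V\<close> is given by its edge set, a subset of \<open>nsets V 2\<close>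
  (the two-element subsets of \<open>V\<close>, i.e. the edges of the complete graph on \<open>V\<close>).
\<close>

definition is_Kk_factor :: "nat \<Rightarrow> 'a set \<Rightarrow> 'a set set \<Rightarrow> 'a set set \<Rightarrow> bool" where
  "is_Kk_factor k V E F \<longleftrightarrow>
     partition_on V F \<and> (\<forall>B\<in>F. finite B \<and> card B = k \<and> nsets B 2 \<subseteq> E)"

text \<open>A factor is stored as a partition; these are the edges of the corresponding graph.\<close>

definition factor_edges :: "'a set set \<Rightarrow> 'a set set" where
  "factor_edges F = (\<Union>B\<in>F. nsets B 2)"

text \<open>The list \<open>Hs\<close> is the tuple of rounds, so \<open>length Hs\<close> is the number of rounds.\<close>

definition is_tournament :: "nat \<Rightarrow> 'a set \<Rightarrow> 'a set set list \<Rightarrow> bool" where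
  "is_tournament k V Hs \<longleftrightarrow>
     (\<forall>H\<in>set Hs. is_Kk_factor k V (nsets V 2) H) \<and>
     (\<forall>e\<in>nsets V 2. \<forall>i<length Hs. \<forall>j<length Hs.
        e \<in> factor_edges (Hs ! i) \<longrightarrow> e \<in> factor_edges (Hs ! j) \<longrightarrow> i = j)"

definition feasibility_graph :: "'a set \<Rightarrow> 'a set set list \<Rightarrow> 'a set set" where
  "feasibility_graph V Hs = nsets V 2 - (\<Union>H\<in>set Hs. factor_edges H)"

definition can_be_extended :: "nat \<Rightarrow> 'a set \<Rightarrow> 'a set set list \<Rightarrow> bool" where
  "can_be_extended k V Hs \<longleftrightarrow> (\<exists>F. is_Kk_factor k V (feasibility_graph V Hs) F)"

end

theory Submission
  imports Defs Complex_Main "HOL-Number_Theory.Number_Theory" "HOL-Computational_Algebra.Computational_Algebra"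
begin

text \<open>
  Let \<open>p\<close> be a large prime with \<open>p \<equiv> 1 (mod k (k - 1))\<close> and \<open>m = k p\<close>, \<open>n = k (m - 1)\<close>, so that the
  number of rounds is \<open>r = (m - 1) / (k - 1)\<close>. If the rounds restricted to a set \<open>A\<close> of \<open>m = n / k + 1\<close>
  players form a resolvable design in which every pair of \<open>A\<close> meets, then the \<open>n / k\<close> blocks of an
  extension would each contain at most one player of \<open>A\<close>, which is impossible. The other \<open>n - m\<close> players
  are scheduled by parallel classes of lines.

  The resolvable design is the Ray-Chaudhuri--Wilson construction from a difference family over \<open>\<int>/p\<close>
  with disjoint blocks. Such a family consists of multiples of one base block whose differences lie in
  prescribed cosets of the subgroup of index \<open>k (k - 1) / 2\<close>. The elements of the base block are chosen one
  at a time: a second moment bound for incidences of points and lines over \<open>\<int>/p\<close> shows that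
  all but boundedly many choices leave a positive proportion of the candidates for the later elements.
\<close>

section \<open>Primes congruent to 1\<close>

text \<open>
  \<open>L\<close> plays the role of \<open>\<Prod>d. \<Phi>\<^sub>d\<close> over the proper divisors \<open>d\<close> of \<open>n\<close>. If no prime had \<open>a\<close> as an element
  of order \<open>n\<close>, then \<open>a ^ n - 1\<close> would divide the smaller number \<open>poly L a\<close>.
\<close>

lemma low_degree_common_multiple_exists:
  fixes n :: nat
  assumes "n > 0"
  shows "\<exists>L :: int poly. L \<noteq> 0 \<and> degree L < n \<and>
           (\<forall>q. prime q \<and> q dvd n \<longrightarrow> monom 1 (n div q) - 1 dvd L)"
proof -
  define X where "X m = (monom 1 m - 1 :: int poly)" for m :: nat
  define Q where "Q = {q. prime q \<and> q dvd n}"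
  have fin: "finite Q"
    unfolding Q_def using finite_divisors_nat[OF assms] by (rule rev_finite_subset) auto
  have Xcoeff: "coeff (X m) m = 1" if "m > 0" for m
    using that by (simp add: X_def)
  have Xnz: "X m \<noteq> 0" if "m > 0" for m
    using Xcoeff[OF that] by force
  have degX: "degree (X m) = m" for m
  proof (cases "m = 0")
    case False
    then show ?thesis unfolding X_def
      by (subst diff_conv_add_uminus, subst degree_add_eq_left) (auto simp: degree_monom_eq)
  qed (simp add: X_def)
  have Xmult: "X m dvd X (m * j)" for m j
  proof -
    have "monom 1 (m * j) - 1 = (monom 1 m :: int poly) ^ j - 1 ^ j"
      by (simp add: monom_power)
    also have "\<dots> = (monom 1 m - 1) * (\<Sum>i<j. 1 ^ (j - Suc i) * monom 1 m ^ i)"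
      by (rule power_diff_sumr2)
    finally show ?thesis unfolding X_def by simp
  qed
  have pos: "n div q > 0" if "q \<in> Q" for q
    using that assms unfolding Q_def by (auto elim!: dvdE)
  define L where "L = Lcm ((\<lambda>q. X (n div q)) ` Q)"
  have dv: "X (n div q) dvd L" if "q \<in> Q" for q
    unfolding L_def using that by (intro dvd_Lcm) auto
  have Ln: "L dvd X n" unfolding L_def
  proof (rule Lcm_least)
    fix y assume "y \<in> (\<lambda>q. X (n div q)) ` Q"
    then obtain q where q: "q \<in> Q" "y = X (n div q)" by auto
    have "n = (n div q) * q" using q by (auto simp: Q_def)
    then show "y dvd X n" using Xmult[of "n div q" q] q by simp
  qed
  have Lp: "L dvd (\<Prod>q\<in>Q. X (n div q))" unfolding L_def
    by (rule Lcm_least) (auto intro: dvd_prodI fin)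
  have Lnz: "L \<noteq> 0" using Ln Xnz[OF assms] by auto
  have "degree L \<le> n" using dvd_imp_degree_le[OF Ln Xnz[OF assms]] degX by simp
  moreover have "degree L \<noteq> n"
  proof
    \<comment> \<open>In this case the cofactor \<open>c\<close> is a constant dividing the leading
      coefficient 1 of \<open>X n\<close>, hence a unit, and \<open>X n\<close> itself divides the
      product of the \<open>X (n div q)\<close>.\<close>
    assume d: "degree L = n"
    obtain c where c: "X n = L * c" using Ln by (auto elim: dvdE)
    have "c \<noteq> 0" using c Xnz[OF assms] by auto
    then have "degree c = 0" using c degX[of n] d Lnz by (simp add: degree_mult_eq)
    then obtain c0 where c0: "c = [:c0:]" by (rule degree_eq_zeroE)
    have "1 = coeff L n * c0" using Xcoeff[OF assms] c c0 by (simp add: mult.commute)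
    then have "c0 dvd 1" by (metis dvd_triv_right)
    then have "is_unit c" using c0 by (simp add: is_unit_const_poly_iff)
    then have "X n dvd L" using c by (metis dvd_mult_unit_iff dvd_refl)
    then have "X n dvd (\<Prod>q\<in>Q. X (n div q))" using Lp by (rule dvd_trans)
    then obtain r where r: "(\<Prod>q\<in>Q. X (n div q)) = X n * r" by (auto elim: dvdE)
    \<comment> \<open>\<open>z\<close> is a primitive \<open>n\<close>-th root of unity:
      \<open>X n\<close> vanishes there, whereas a vanishing factor \<open>X (n div q)\<close> would
      give \<open>cis (2 * pi / q) = 1\<close> with \<open>q > 1\<close>.\<close>
    define z where "z = cis (2 * pi / n)"
    define ev where "ev p = poly (map_poly of_int p) z" for p :: "int poly"
    have evm: "ev (p * q) = ev p * ev q" for p q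
    proof -
      have "(map_poly of_int (p * q) :: complex poly) = map_poly of_int p * map_poly of_int q"
        by (intro poly_eqI) (simp add: coeff_map_poly coeff_mult)
      then show ?thesis by (simp add: ev_def)
    qed
    have evX: "ev (X m) = z ^ m - 1" for m
    proof -
      have "(map_poly of_int (X m) :: complex poly) = monom 1 m - 1"
        by (intro poly_eqI) (simp add: coeff_map_poly X_def coeff_1)
      then show ?thesis by (simp add: ev_def poly_monom)
    qed
    have "ev (\<Prod>q\<in>Q. X (n div q)) = (\<Prod>q\<in>Q. ev (X (n div q)))"
      using fin by (induction Q) (auto simp: evm, simp add: ev_def)
    moreover have "ev (X n) = 0" using assms unfolding evX z_def
      by (simp add: DeMoivre)
    ultimately have "(\<Prod>q\<in>Q. z ^ (n div q) - 1) = 0" using r evm evX by simp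
    then obtain q where q: "q \<in> Q" "z ^ (n div q) = 1" using fin by auto
    have q1: "q > 1" using q prime_gt_1_nat[of q] by (simp add: Q_def)
    have "real (n div q) * (2 * pi / n) = 2 * pi / q"
      using q assms q1 by (auto simp: Q_def field_simps real_of_nat_div)
    then have "cis (2 * pi / q) = 1" using q(2) by (simp add: z_def DeMoivre)
    then have "cos (2 * pi / q) = 1" by (metis cis.sel(1) one_complex.sel(1))
    then obtain m :: int where m: "2 * pi / q = of_int m * 2 * pi"
      using cos_one_2pi_int by auto
    have "1 = real q * of_int m" using m q1 by (simp add: field_simps)
    then have "1 = int q * m" by (metis of_int_eq_iff of_int_mult of_int_of_nat_eq of_int_1)
    then show False using q1 by (metis dvd_triv_left int_dvd_int_iff nat_dvd_1_iff_1 of_nat_1 less_irrefl)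
  qed
  ultimately show ?thesis using dv Lnz unfolding Q_def X_def by (intro exI[of _ L]) auto
qed

text \<open>A prime \<open>p\<close> that divides \<open>a ^ n - 1\<close> but no
  \<open>a ^ (n div q) - 1\<close>, for \<open>q\<close> a prime divisor of \<open>n\<close>, has
  \<open>a\<close> as an element of order \<open>n\<close>, so \<open>n\<close> divides
  \<open>p - 1\<close>. Without such a prime, comparing multiplicities would make
  \<open>a ^ n - 1\<close> divide the nonzero number \<open>poly L a\<close>, which is too
  small.\<close>

lemma prime_cong_1_above:
  fixes n N :: nat
  assumes "n > 1"
  shows "\<exists>p. prime p \<and> p > N \<and> n dvd p - 1"
proof -
  obtain L :: "int poly" where L: "L \<noteq> 0" "degree L < n"
    "\<And>q. prime q \<Longrightarrow> q dvd n \<Longrightarrow> monom 1 (n div q) - 1 dvd L"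
    using low_degree_common_multiple_exists[of n] assms by auto
  define S where "S = (\<Sum>i\<le>degree L. \<bar>coeff L i\<bar>)"
  have S0: "S \<ge> 0" unfolding S_def by (rule sum_nonneg) auto
  have bound: "\<bar>poly L x\<bar> \<le> S * x ^ (n - 1)" if "x \<ge> 1" for x
  proof -
    have "\<bar>poly L x\<bar> \<le> (\<Sum>i\<le>degree L. \<bar>coeff L i * x ^ i\<bar>)"
      unfolding poly_altdef by (rule sum_abs)
    also have "\<dots> \<le> (\<Sum>i\<le>degree L. \<bar>coeff L i\<bar> * x ^ (n - 1))"
    proof (rule sum_mono)
      fix i assume i: "i \<in> {..degree L}"
      have "x ^ i \<le> x ^ (n - 1)" using that i L(2) by (intro power_increasing) auto
      then show "\<bar>coeff L i * x ^ i\<bar> \<le> \<bar>coeff L i\<bar> * x ^ (n - 1)"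
        using that by (auto simp: abs_mult intro!: mult_left_mono)
    qed
    finally show ?thesis by (simp add: S_def sum_distrib_right)
  qed
  have "finite {x. poly L x = 0}" using L(1) by (rule poly_roots_finite)
  then obtain B where B: "\<And>x. poly L x = 0 \<Longrightarrow> x < B"
    using bdd_above_finite[of "{x. poly L x = 0}"] unfolding bdd_above_def
    by (metis (mono_tags, lifting) mem_Collect_eq zle_add1_eq_le)
  define T where "T = nat (max B (S + 2))"
  \<comment> \<open>The factor \<open>n\<close> keeps the prime divisors of \<open>a ^ n - 1\<close>
    away from \<open>n\<close>, the factor \<open>fact N\<close> keeps them above \<open>N\<close>,
    and \<open>T + 1\<close> pushes \<open>a\<close> beyond the roots of \<open>L\<close> and makes
    \<open>poly L a\<close> smaller than \<open>a ^ n - 1\<close>.\<close>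
  define a where "a = n * fact N * (T + 1)"
  have "1 * (T + 1) \<le> a" unfolding a_def using assms
    by (intro mult_le_mono1) (simp add: Suc_le_eq)
  then have aT: "a > T" by simp
  have a: "int a > B" "int a > S + 2" using aT S0 by (auto simp: T_def)
  have nz: "poly L (int a) \<noteq> 0" using B a(1) by force
  have small: "\<bar>poly L (int a)\<bar> < int a ^ n - 1"
  proof -
    have "\<bar>poly L (int a)\<bar> \<le> S * int a ^ (n - 1)" using bound a S0 by auto
    also have "\<dots> \<le> (int a - 2) * int a ^ (n - 1)" using a by (intro mult_right_mono) auto
    also have "\<dots> = int a ^ n - 2 * int a ^ (n - 1)"
      using assms by (cases n) (auto simp: algebra_simps)
    also have "\<dots> < int a ^ n - 1"
      using one_le_power[of "int a" "n - 1"] a S0 by linarith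
    finally show ?thesis .
  qed
  have "\<exists>p. prime p \<and> int p dvd int a ^ n - 1 \<and>
      (\<forall>q. prime q \<and> q dvd n \<longrightarrow> \<not> int p dvd int a ^ (n div q) - 1)"
  proof (rule ccontr)
    assume neg: "\<not> ?thesis"
    have "int a ^ n - 1 dvd poly L (int a)"
    proof (rule multiplicity_le_imp_dvd)
      show "int a ^ n - 1 \<noteq> 0" using small by linarith
      fix p :: int assume p: "prime p"
      show "multiplicity p (int a ^ n - 1) \<le> multiplicity p (poly L (int a))"
      proof (cases "p dvd int a ^ n - 1")
        case False
        then show ?thesis by (simp add: not_dvd_imp_multiplicity_0)
      next
        case True
        have "int (nat p) = p" "prime (nat p)" using p by (auto simp: prime_ge_0_int)
        then obtain q where q: "prime q" "q dvd n" "p dvd int a ^ (n div q) - 1"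
          using neg True by metis
        \<comment> \<open>The second factor of \<open>y ^ q - 1 = a ^ n - 1\<close> is congruent to
          \<open>q\<close> modulo \<open>p\<close>, and \<open>p\<close> does not divide
          \<open>q\<close>, since \<open>q\<close> divides \<open>a\<close>. So the whole power of
          \<open>p\<close> in \<open>a ^ n - 1\<close> sits in \<open>y - 1\<close>, which divides
          \<open>poly L a\<close>.\<close>
        define y where "y = int a ^ (n div q)"
        have "y ^ q = int a ^ n" using q by (simp add: y_def flip: power_mult)
        then have eq: "int a ^ n - 1 = (y - 1) * (\<Sum>i<q. y ^ i)"
          using power_diff_1_eq[of y q] by simp
        have "[(\<Sum>i<q. y ^ i) = (\<Sum>i<q. 1 ^ i)] (mod p)"
          using q(3) by (intro cong_sum cong_pow) (auto simp: cong_iff_dvd_diff y_def)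
        then have c: "[(\<Sum>i<q. y ^ i) = int q] (mod p)" by simp
        have "\<not> p dvd int q"
        proof
          assume "p dvd int q"
          then have "p dvd int a" using q by (auto simp: a_def intro: dvd_mult2 dvd_trans)
          then have "p dvd int a ^ n" using assms by (simp add: dvd_power_same dvd_trans[OF _ dvd_power])
          then have "p dvd int a ^ n - (int a ^ n - 1)" using True by (rule dvd_diff)
          then show False using p not_prime_unit by (auto simp: abs_if)
        qed
        then have "\<not> p dvd (\<Sum>i<q. y ^ i)" using cong_dvd_iff[OF c] by simp
        moreover have "(\<Sum>i<q. y ^ i) \<noteq> 0" "y - 1 \<noteq> 0" using eq small by auto
        ultimately have "multiplicity p (int a ^ n - 1) = multiplicity p (y - 1)"
          unfolding eq using p
          by (subst prime_elem_multiplicity_mult_distrib) (auto simp: not_dvd_imp_multiplicity_0)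
        also have "\<dots> \<le> multiplicity p (poly L (int a))"
        proof (rule dvd_imp_multiplicity_le)
          show "poly L (int a) \<noteq> 0" by (rule nz)
          obtain M where "L = (monom 1 (n div q) - 1) * M" using L(3)[OF q(1,2)] by (auto elim: dvdE)
          then have "poly L (int a) = (y - 1) * poly M (int a)"
            by (simp add: y_def poly_monom)
          then show "y - 1 dvd poly L (int a)" by simp
        qed
        finally show ?thesis .
      qed
    qed
    then show False using dvd_imp_le_int[OF nz, of "int a ^ n - 1"] small by linarith
  qed
  then obtain p where p: "prime p" "int p dvd int a ^ n - 1"
    "\<And>q. prime q \<Longrightarrow> q dvd n \<Longrightarrow> \<not> int p dvd int a ^ (n div q) - 1" by auto
  have cong1: "[a ^ m = 1] (mod p) \<longleftrightarrow> int p dvd int a ^ m - 1" for m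
    by (metis cong_iff_dvd_diff cong_int_iff of_nat_1 of_nat_power)
  have ordn: "ord p a dvd n" using p(2) cong1 ord_divides by blast
  have "ord p a = n"
  proof (rule ccontr)
    assume "ord p a \<noteq> n"
    obtain j where j: "n = ord p a * j" using ordn by (auto elim: dvdE)
    then have "j \<noteq> 1" using \<open>ord p a \<noteq> n\<close> by auto
    then obtain q where q: "prime q" "q dvd j" using prime_factor_nat by blast
    then obtain i where "j = q * i" by (auto elim: dvdE)
    then have "n div q = ord p a * i" using j q by (simp add: prime_gt_0_nat)
    then have "[a ^ (n div q) = 1] (mod p)" using ord_divides by simp
    then show False using p(3)[OF q(1)] q j cong1 by simp
  qed
  moreover have "coprime p a"
  proof -
    have "\<not> p dvd a"
    proof
      assume "p dvd a"
      then have "int p dvd int a ^ n" using assms by (simp add: dvd_trans[OF _ dvd_power])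
      then have "int p dvd int a ^ n - (int a ^ n - 1)" using p(2) by (rule dvd_diff)
      then show False using p(1) not_prime_1 by (simp add: prime_nat_iff)
    qed
    then show ?thesis using p(1) by (simp add: prime_imp_coprime)
  qed
  ultimately have "n dvd p - 1" using order_divides_totient[of p a] p(1) by (simp add: totient_prime)
  moreover have "p > N"
  proof (rule ccontr)
    assume "\<not> p > N"
    then have "p dvd fact N" using p(1) by (simp add: prime_dvd_fact_iff)
    then have "p dvd a" by (auto simp: a_def)
    then show False using \<open>coprime p a\<close> p(1) by (metis coprime_absorb_left not_prime_unit)
  qed
  ultimately show ?thesis using p(1) by auto
qed

section \<open>Difference families over prime fields\<close>

text \<open>\<open>card P / p\<close> is the average number of points on a non-vertical line. Each
  point lies on one line of every slope and two distinct points share at most one line, so the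
  squared counts add up to at most \<open>p * card P + (card P)\<^sup>2\<close>; centring at the
  average removes the second term.\<close>

lemma line_incidence_variance:
  fixes p :: int and P :: "(int \<times> int) set"
  assumes p: "prime p" and P: "P \<subseteq> {0..<p} \<times> {0..<p}"
  shows "(\<Sum>s\<in>{0..<p}. \<Sum>t\<in>{0..<p}.
           (real (card {z\<in>P. [snd z = s * fst z + t] (mod p)}) - real (card P) / p)\<^sup>2)
         \<le> p * card P"
proof -
  define Z where "Z = {0..<p}"
  define on where "on s t z \<longleftrightarrow> [snd z = s * fst z + t] (mod p)" for s t and z :: "int \<times> int"
  define N where "N s t = real (card {z\<in>P. on s t z})" for s t
  define S where "S = real (card P)"
  have p0: "p > 0" using p prime_gt_0_int by blast
  have finZ: "finite Z" and cardZ: "card Z = nat p" by (simp_all add: Z_def)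
  have finP: "finite P" using P by (rule finite_subset) simp
  have N: "N s t = (\<Sum>z\<in>P. of_bool (on s t z))" for s t
    unfolding N_def using finP by (simp add: sum.If_cases of_bool_def Int_def)
  have one: "(\<Sum>t\<in>Z. of_bool (on s t z)) = (1 :: real)" for s z
  proof -
    have "on s t z \<longleftrightarrow> t = (snd z - s * fst z) mod p" if "t \<in> Z" for t
    proof -
      have "on s t z \<longleftrightarrow> p dvd t - (snd z - s * fst z)"
        unfolding on_def cong_iff_dvd_diff by (subst dvd_minus_iff[symmetric]) (simp add: algebra_simps)
      also have "\<dots> \<longleftrightarrow> t mod p = (snd z - s * fst z) mod p" by (simp add: mod_eq_dvd_iff)
      also have "t mod p = t" using that by (simp add: Z_def)
      finally show ?thesis .
    qed
    then have "(\<Sum>t\<in>Z. of_bool (on s t z)) = (\<Sum>t\<in>Z. if t = (snd z - s * fst z) mod p then 1 else (0::real))"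
      by (intro sum.cong) auto
    also have "\<dots> = 1" using finZ p0 by (simp add: Z_def)
    finally show ?thesis .
  qed
  have sum1: "(\<Sum>s\<in>Z. \<Sum>t\<in>Z. N s t) = p * S"
  proof -
    have "(\<Sum>s\<in>Z. \<Sum>t\<in>Z. N s t) = (\<Sum>s\<in>Z. \<Sum>z\<in>P. \<Sum>t\<in>Z. of_bool (on s t z))"
      unfolding N by (intro sum.cong refl sum.swap)
    also have "\<dots> = p * S" using p0 by (simp add: one S_def cardZ del: sum_of_bool_eq)
    finally show ?thesis .
  qed
  \<comment> \<open>Equal points share \<open>p\<close> lines, distinct points at most one. Charging
    \<open>1\<close> to the equal pairs as well makes the bounds add up to exactly
    \<open>p * S + S\<^sup>2\<close>.\<close>
  have pair: "(\<Sum>s\<in>Z. \<Sum>t\<in>Z. of_bool (on s t z) * of_bool (on s t w)) \<le> (if z = w then real_of_int p else 0) + 1"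
    if zw: "z \<in> P" "w \<in> P" for z w
  proof (cases "z = w")
    case True
    have "(\<Sum>s\<in>Z. \<Sum>t\<in>Z. of_bool (on s t z) * of_bool (on s t w))
        = (\<Sum>s\<in>Z. \<Sum>t\<in>Z. of_bool (on s t z) :: real)"
      using True by (intro sum.cong) auto
    then show ?thesis using True p0 by (simp add: one cardZ del: sum_of_bool_eq)
  next
    case False
    define D where "D = {st \<in> Z \<times> Z. on (fst st) (snd st) z \<and> on (fst st) (snd st) w}"
    have finD: "finite D" unfolding D_def using finZ by simp
    have "(\<Sum>s\<in>Z. \<Sum>t\<in>Z. of_bool (on s t z) * of_bool (on s t w))
        = (\<Sum>st\<in>Z\<times>Z. of_bool (on (fst st) (snd st) z \<and> on (fst st) (snd st) w) :: real)"
      by (simp add: sum.cartesian_product case_prod_beta of_bool_conj)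
    also have "\<dots> = real (card D)" unfolding D_def using finZ by (simp add: Int_def)
    also have "card D \<le> 1"
    proof -
      have "a = b" if ab: "a \<in> D" "b \<in> D" for a b
      proof -
        obtain s t s' t' where [simp]: "a = (s, t)" "b = (s', t')" by fastforce
        obtain x y x' y' where [simp]: "z = (x, y)" "w = (x', y')" by fastforce
        have c: "p dvd y - (s * x + t)" "p dvd y' - (s * x' + t)"
             "p dvd y - (s' * x + t')" "p dvd y' - (s' * x' + t')"
          using ab by (auto simp: D_def on_def cong_iff_dvd_diff)
        have rng: "0 \<le> x" "x < p" "0 \<le> x'" "x' < p" "0 \<le> y" "y < p" "0 \<le> y'" "y' < p"
          using zw P by auto
        have rng2: "0 \<le> s" "s < p" "0 \<le> s'" "s' < p" "0 \<le> t" "t < p" "0 \<le> t'" "t' < p"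
          using ab by (auto simp: D_def Z_def)
        have eqI: "u = v" if "p dvd u - v" "0 \<le> u" "u < p" "0 \<le> v" "v < p" for u v
          using that by (metis mod_eq_dvd_iff mod_pos_pos_trivial)
        have "x \<noteq> x'"
        proof
          assume "x = x'"
          then have "p dvd y - y'" using dvd_diff[OF c(1,2)] by simp
          then show False using eqI[of y y'] rng False \<open>x = x'\<close> by simp
        qed
        then have "\<not> p dvd x - x'" using eqI[of x x'] rng by blast
        have "p dvd (s' - s) * (x - x')"
          using dvd_diff[OF dvd_diff[OF c(1) c(2)] dvd_diff[OF c(3) c(4)]] by (simp add: algebra_simps)
        then have "p dvd s' - s" using p \<open>\<not> p dvd x - x'\<close> prime_dvd_multD by blast
        then have ss: "s' = s" using eqI[of s' s] rng2 by blast
        then have "p dvd t' - t" using dvd_diff[OF c(1) c(3)] by (simp add: algebra_simps)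
        then have "t' = t" using eqI[of t' t] rng2 by blast
        then show ?thesis using ss by simp
      qed
      then show ?thesis using finD by (simp add: card_le_Suc0_iff_eq)
    qed
    finally show ?thesis using False by simp
  qed
  have sum2: "(\<Sum>s\<in>Z. \<Sum>t\<in>Z. (N s t)\<^sup>2) \<le> p * S + S\<^sup>2"
  proof -
    have "(\<Sum>s\<in>Z. \<Sum>t\<in>Z. (N s t)\<^sup>2)
        = (\<Sum>s\<in>Z. \<Sum>t\<in>Z. \<Sum>z\<in>P. \<Sum>w\<in>P. of_bool (on s t z) * of_bool (on s t w))"
      unfolding N power2_eq_square sum_product ..
    also have "\<dots> = (\<Sum>s\<in>Z. \<Sum>z\<in>P. \<Sum>t\<in>Z. \<Sum>w\<in>P. of_bool (on s t z) * of_bool (on s t w))"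
      by (intro sum.cong refl sum.swap)
    also have "\<dots> = (\<Sum>s\<in>Z. \<Sum>z\<in>P. \<Sum>w\<in>P. \<Sum>t\<in>Z. of_bool (on s t z) * of_bool (on s t w))"
      by (intro sum.cong refl sum.swap)
    also have "\<dots> = (\<Sum>z\<in>P. \<Sum>s\<in>Z. \<Sum>w\<in>P. \<Sum>t\<in>Z. of_bool (on s t z) * of_bool (on s t w))"
      by (rule sum.swap)
    also have "\<dots> = (\<Sum>z\<in>P. \<Sum>w\<in>P. \<Sum>s\<in>Z. \<Sum>t\<in>Z. of_bool (on s t z) * of_bool (on s t w))"
      by (intro sum.cong refl sum.swap)
    also have "\<dots> \<le> (\<Sum>z\<in>P. \<Sum>w\<in>P. (if z = w then real_of_int p else 0) + 1)"
      by (intro sum_mono pair)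
    also have "\<dots> = p * S + S\<^sup>2"
      using finP by (simp add: sum.distrib S_def power2_eq_square algebra_simps)
    finally show ?thesis .
  qed
  have "(\<Sum>s\<in>Z. \<Sum>t\<in>Z. (N s t - S / p)\<^sup>2)
      = (\<Sum>s\<in>Z. \<Sum>t\<in>Z. (N s t)\<^sup>2) - 2 * (S / p) * (\<Sum>s\<in>Z. \<Sum>t\<in>Z. N s t) + real (card Z) * real (card Z) * (S / p)\<^sup>2"
    by (simp add: power2_diff sum.distrib sum_subtractf sum_distrib_left sum_divide_distrib algebra_simps)
  also have "\<dots> = (\<Sum>s\<in>Z. \<Sum>t\<in>Z. (N s t)\<^sup>2) - S\<^sup>2"
    unfolding sum1 cardZ using p0 by (simp add: power2_eq_square field_simps)
  also have "\<dots> \<le> p * S" using sum2 by simp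
  finally show ?thesis unfolding N_def S_def Z_def on_def by simp
qed

section \<open>Prescribing the cosets of differences\<close>

text \<open>\<open>col\<close> models the discrete logarithm to a primitive root, reduced modulo
  \<open>f\<close>: on the units it is a homomorphism to the integers modulo \<open>f\<close>, and
  its classes are the cosets of the subgroup of index \<open>f\<close>. Multiples of
  \<open>p\<close> also receive a colour, so colour conditions are paired with
  non-divisibility.\<close>

locale residue_colouring =
  fixes p :: int and f :: nat and col :: "int \<Rightarrow> nat"
  assumes prime: "prime p" and f_pos: "f > 0"
    and col_less: "col x < f"
    and col_cong: "[x = y] (mod p) \<Longrightarrow> col x = col y"
    and col_mult: "\<not> p dvd x \<Longrightarrow> \<not> p dvd y \<Longrightarrow> col (x * y) = (col x + col y) mod f"
    and card_class: "c < f \<Longrightarrow> int (card {x\<in>{0..<p}. \<not> p dvd x \<and> col x = c} * f) = p - 1"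
begin

text \<open>For \<open>s\<close> in class \<open>c\<close>, the line of slope \<open>s\<close> and
  intercept \<open>u\<close> meets \<open>K 0 \<times> V\<close> only in points whose second
  coordinate \<open>v\<close> has \<open>v - u\<close> in class \<open>c\<close>. If at most half of
  the expected \<open>card V / f\<close> elements \<open>v\<close> are of this kind, all these lines
  deviate from the mean, and the variance bound limits the number of such \<open>u\<close>.\<close>

lemma card_sparse_translates:
  assumes p4: "p \<ge> 4" and V: "V \<subseteq> {0..<p}" and c: "c < f" and U: "U \<subseteq> {0..<p}"
    and sparse: "\<And>u. u \<in> U \<Longrightarrow> card {v\<in>V. \<not> p dvd v - u \<and> col (v - u) = c} * (2 * f) \<le> card V"
  shows "real (card U) * real (card V) \<le> 16 * real f ^ 2 * p"
proof (cases "card V = 0")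
  case True
  then show ?thesis using p4 by simp
next
  case False
  define K where "K c = {x\<in>{0..<p}. \<not> p dvd x \<and> col x = c}" for c
  define h where "h = card (K 0)"
  have hf: "real h * f = p - 1"
  proof -
    have "int (h * f) = p - 1" using card_class[OF f_pos] by (simp add: h_def K_def)
    then show ?thesis by (metis of_int_diff of_int_of_nat_eq of_int_1 of_nat_mult)
  qed
  have cardK: "real (card (K c)) = h"
  proof -
    have "int (card (K c) * f) = int (h * f)"
      using card_class[OF f_pos] card_class[OF c] by (simp add: h_def K_def)
    then show ?thesis using f_pos by (metis mult_cancel2 neq0_conv of_nat_eq_iff)
  qed
  define P where "P = K 0 \<times> V"
  define A where "A = real (card P) / p"
  define n where "n s t = real (card {z\<in>P. [snd z = s * fst z + t] (mod p)})" for s t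
  have h0: "h > 0" using hf p4 by (cases h) auto
  have finV: "finite V" using V by (rule finite_subset) simp
  have finU: "finite U" using U by (rule finite_subset) simp
  have A: "A = h * card V / p" by (simp add: A_def P_def h_def card_cartesian_product)
  have n_le: "n s u \<le> card V / (2 * f)" if s: "s \<in> K c" and u: "u \<in> U" for s u
  proof -
    have "card {z\<in>P. [snd z = s * fst z + u] (mod p)} \<le> card {v\<in>V. \<not> p dvd v - u \<and> col (v - u) = c}"
    proof (rule card_inj_on_le[where f = snd])
      show "inj_on snd {z\<in>P. [snd z = s * fst z + u] (mod p)}"
      proof (rule inj_onI)
        fix z w assume z: "z \<in> {z\<in>P. [snd z = s * fst z + u] (mod p)}"
          and w: "w \<in> {z\<in>P. [snd z = s * fst z + u] (mod p)}" and eq: "snd z = snd w"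
        have "[s * fst z + u = s * fst w + u] (mod p)"
          using z w eq by (metis (mono_tags, lifting) cong_sym cong_trans mem_Collect_eq)
        then have "[s * fst z = s * fst w] (mod p)" by (simp add: cong_add_rcancel)
        then have "p dvd s * (fst z - fst w)" by (simp add: cong_iff_dvd_diff right_diff_distrib)
        then have "p dvd fst z - fst w" using s prime by (simp add: K_def prime_dvd_mult_iff)
        moreover have "fst z \<in> {0..<p}" "fst w \<in> {0..<p}" using z w by (auto simp: P_def K_def)
        ultimately have "fst z = fst w" by (metis atLeastLessThan_iff mod_eq_dvd_iff mod_pos_pos_trivial)
        then show "z = w" using eq by (simp add: prod_eq_iff)
      qed
      show "snd ` {z\<in>P. [snd z = s * fst z + u] (mod p)} \<subseteq> {v\<in>V. \<not> p dvd v - u \<and> col (v - u) = c}"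
      proof clarsimp
        fix x v assume xv: "(x, v) \<in> P" "[v = s * x + u] (mod p)"
        have "[v - u = s * x + u - u] (mod p)" using xv(2) by (intro cong_diff) auto
        then have cg: "[v - u = s * x] (mod p)" by simp
        have x: "\<not> p dvd x" "col x = 0" using xv(1) by (auto simp: P_def K_def)
        have s': "\<not> p dvd s" "col s = c" using s by (auto simp: K_def)
        have "\<not> p dvd s * x" using s' x prime by (simp add: prime_dvd_mult_iff)
        then have "\<not> p dvd v - u" using cong_dvd_iff[OF cg] by simp
        moreover have "col (v - u) = c"
          using col_cong[OF cg] col_mult[OF s'(1) x(1)] s' x c by simp
        ultimately show "v \<in> V \<and> \<not> p dvd v - u \<and> col (v - u) = c" using xv(1) by (simp add: P_def)
      qed
      show "finite {v\<in>V. \<not> p dvd v - u \<and> col (v - u) = c}" using finV by simp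
    qed
    then have "card {z\<in>P. [snd z = s * fst z + u] (mod p)} * (2 * f) \<le> card V"
      using sparse[OF u] by (meson le_trans mult_le_mono1)
    then have "real (card {z\<in>P. [snd z = s * fst z + u] (mod p)} * (2 * f)) \<le> card V"
      by (simp only: of_nat_le_iff)
    then show ?thesis using f_pos by (simp add: n_def field_simps)
  qed
  have gap: "(real (card V) / (4 * f))\<^sup>2 \<le> (n s u - A)\<^sup>2" if "s \<in> K c" "u \<in> U" for s u
  proof -
    \<comment> \<open>The mean is \<open>(p - 1) / p\<close> times \<open>card V / f\<close>, at
      least three quarters of it as \<open>p \<ge> 4\<close>. A line through a sparse
      \<open>u\<close> carries at most half of \<open>card V / f\<close>, so at least a quarter is
      missing.\<close>
    have "A = (real h * f) / p * (card V / f)" unfolding A using f_pos by simp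
    also have "\<dots> = (p - 1) / p * (card V / f)" by (simp only: hf of_int_diff of_int_1)
    also have "\<dots> \<ge> 3 / 4 * (card V / f)"
      using p4 f_pos by (intro mult_right_mono) (auto simp: field_simps)
    finally have "A - card V / (2 * f) \<ge> card V / (4 * f)" using f_pos by (simp add: field_simps)
    then have "A - n s u \<ge> card V / (4 * f)" using n_le[OF that] by linarith
    then have "(real (card V) / (4 * f))\<^sup>2 \<le> (A - n s u)\<^sup>2" by (intro power_mono) auto
    then show ?thesis by (simp add: power2_commute)
  qed
  \<comment> \<open>Each \<open>u\<close> in \<open>U\<close> yields \<open>h\<close> deviating
    lines, one for every slope in \<open>K c\<close>. This factor \<open>h\<close> cancels against
    the one in \<open>card P\<close>.\<close>
  have "real h * card U * (real (card V) / (4 * f))\<^sup>2 = (\<Sum>s\<in>K c. \<Sum>u\<in>U. (real (card V) / (4 * f))\<^sup>2)"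
    by (simp add: cardK)
  also have "\<dots> \<le> (\<Sum>s\<in>K c. \<Sum>u\<in>U. (n s u - A)\<^sup>2)"
    by (intro sum_mono gap)
  also have "\<dots> \<le> (\<Sum>s\<in>K c. \<Sum>u\<in>{0..<p}. (n s u - A)\<^sup>2)"
    using U by (intro sum_mono sum_mono2) auto
  also have "\<dots> \<le> (\<Sum>s\<in>{0..<p}. \<Sum>u\<in>{0..<p}. (n s u - A)\<^sup>2)"
    by (intro sum_mono2 sum_nonneg) (auto simp: K_def)
  also have "\<dots> \<le> p * card P"
    unfolding n_def A_def using V by (intro line_incidence_variance prime) (auto simp: P_def K_def)
  also have "\<dots> = real h * (p * card V)" by (simp add: P_def h_def card_cartesian_product)
  finally have "card U * (real (card V) / (4 * f))\<^sup>2 \<le> p * card V"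
    using h0 by (simp add: mult.assoc)
  then have "(card U * real (card V)) * card V \<le> (16 * real f ^ 2 * p) * card V"
    using f_pos by (simp add: power2_eq_square field_simps)
  then show ?thesis using False by (simp add: mult_le_cancel_right)
qed

end

text \<open>Greedy choice: the first element \<open>u\<close> avoids the bad residues, whose number
  is bounded independently of \<open>p\<close>. The later elements then come from the smaller
  candidate sets \<open>W u i\<close>, still of positive density, which is why the induction ranges
  over all \<open>\<epsilon>\<close>.\<close>

lemma prescribed_difference_colours:
  fixes f n :: nat and \<epsilon> :: real
  assumes "\<epsilon> > 0"
  shows "\<exists>p0. \<forall>p col V c. residue_colouring p f col \<longrightarrow> p \<ge> p0 \<longrightarrow>
      (\<forall>i<n. V i \<subseteq> {0..<p} \<and> real (card (V i)) \<ge> \<epsilon> * p) \<longrightarrow> (\<forall>i j. c i j < f) \<longrightarrow>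
      (\<exists>x. (\<forall>i<n. x i \<in> V i) \<and>
           (\<forall>j<n. \<forall>i<j. \<not> p dvd x j - x i \<and> col (x j - x i) = c i j))"
  using assms
proof (induction n arbitrary: \<epsilon>)
  case 0
  then show ?case by simp
next
  case (Suc n)
  show ?case
  proof (cases "f = 0")
    case True
    then show ?thesis by simp
  next
    case False
    then have f0: "f > 0" by simp
    \<comment> \<open>A residue that is not bad keeps more than the fraction
      \<open>1 / (2 * f)\<close> of each later candidate set.\<close>
    define \<delta> where "\<delta> = \<epsilon> / (2 * f)"
    have "\<delta> > 0" using Suc.prems f0 by (simp add: \<delta>_def)
    from Suc.IH[OF this] obtain p0 where IH: "\<And>p col V c. residue_colouring p f col \<Longrightarrow> p \<ge> p0 \<Longrightarrow>
      (\<forall>i<n. V i \<subseteq> {0..<p} \<and> real (card (V i)) \<ge> \<delta> * p) \<Longrightarrow> (\<forall>i j. c i j < f) \<Longrightarrow>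
      (\<exists>x. (\<forall>i<n. x i \<in> V i) \<and>
           (\<forall>j<n. \<forall>i<j. \<not> p dvd x j - x i \<and> col (x j - x i) = c i j))" by blast
    \<comment> \<open>At most \<open>q * \<epsilon>\<close> residues are bad in total, fewer than
      the \<open>\<epsilon> * p\<close> guaranteed elements of \<open>V 0\<close> once
      \<open>p > q\<close>.\<close>
    define q where "q = real n * (16 * real f ^ 2 / \<epsilon>) / \<epsilon>"
    define p1 where "p1 = max (max p0 4) (\<lceil>q\<rceil> + 1)"
    show ?thesis
    proof (rule exI[of _ p1], intro allI impI)
      fix p col and V :: "nat \<Rightarrow> int set" and c :: "nat \<Rightarrow> nat \<Rightarrow> nat"
      assume rc: "residue_colouring p f col" and p: "p \<ge> p1"
        and V: "\<forall>i<Suc n. V i \<subseteq> {0..<p} \<and> real (card (V i)) \<ge> \<epsilon> * p" and c: "\<forall>i j. c i j < f"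
      interpret residue_colouring p f col by fact
      have p4: "p \<ge> 4" "p \<ge> p0" "q < p" using p unfolding p1_def by linarith+
      define W where "W u i = {v \<in> V (Suc i). \<not> p dvd v - u \<and> col (v - u) = c 0 (Suc i)}" for u i
      define bad where "bad i = {u \<in> {0..<p}. card (W u i) * (2 * f) \<le> card (V (Suc i))}" for i
      have bad: "card (bad i) \<le> 16 * real f ^ 2 / \<epsilon>" if "i < n" for i
      proof -
        have Vi: "V (Suc i) \<subseteq> {0..<p}" "card (V (Suc i)) \<ge> \<epsilon> * p" using V that by auto
        have "real (card (bad i)) * (\<epsilon> * p) \<le> real (card (bad i)) * card (V (Suc i))"
          using Vi by (intro mult_left_mono) auto
        also have "\<dots> \<le> 16 * real f ^ 2 * p"
          by (rule card_sparse_translates[OF p4(1) Vi(1), of "c 0 (Suc i)"]) (use c in \<open>auto simp: bad_def W_def\<close>)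
        finally have "card (bad i) * \<epsilon> * p \<le> 16 * real f ^ 2 * p" by (simp add: mult.assoc)
        then show ?thesis using p4(1) Suc.prems by (simp add: field_simps)
      qed
      have "real (card (\<Union>i<n. bad i)) \<le> (\<Sum>i<n. real (card (bad i)))"
        using card_UN_le[of "{..<n}" bad] by (metis finite_lessThan of_nat_le_iff of_nat_sum)
      also have "\<dots> \<le> (\<Sum>i<n. 16 * real f ^ 2 / \<epsilon>)" using bad by (intro sum_mono) auto
      also have "\<dots> = q * \<epsilon>" using Suc.prems by (simp add: q_def)
      also have "\<dots> < \<epsilon> * p" using p4 Suc.prems by simp
      also have "\<dots> \<le> card (V 0)" using V by simp
      finally have "card (\<Union>i<n. bad i) < card (V 0)" by simp
      moreover have "finite (\<Union>i<n. bad i)"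
        by (rule finite_subset[of _ "{0..<p}"]) (auto simp: bad_def)
      ultimately have "\<not> V 0 \<subseteq> (\<Union>i<n. bad i)" by (meson card_mono not_le)
      then obtain u where u: "u \<in> V 0" "\<And>i. i < n \<Longrightarrow> u \<notin> bad i" by blast
      have "u \<in> {0..<p}" using u V by blast
      have W: "W u i \<subseteq> {0..<p} \<and> real (card (W u i)) \<ge> \<delta> * p" if "i < n" for i
      proof
        show "W u i \<subseteq> {0..<p}" using V that by (auto simp: W_def)
        have "card (W u i) * (2 * f) \<ge> card (V (Suc i))"
          using u(2)[OF that] \<open>u \<in> {0..<p}\<close> by (auto simp: bad_def)
        then have "real (card (W u i) * (2 * f)) \<ge> card (V (Suc i))" by (simp only: of_nat_le_iff)
        then have "real (card (W u i)) * (2 * f) \<ge> \<epsilon> * p" using V that by (smt (verit) Suc_less_eq of_nat_mult of_nat_numeral)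
        then show "real (card (W u i)) \<ge> \<delta> * p" using f0 by (simp add: \<delta>_def field_simps)
      qed
      obtain x where x: "\<forall>i<n. x i \<in> W u i"
        "\<forall>j<n. \<forall>i<j. \<not> p dvd x j - x i \<and> col (x j - x i) = c (Suc i) (Suc j)"
        using IH[OF rc p4(2), of "W u" "\<lambda>i j. c (Suc i) (Suc j)"] W c by blast
      show "\<exists>x. (\<forall>i<Suc n. x i \<in> V i) \<and>
           (\<forall>j<Suc n. \<forall>i<j. \<not> p dvd x j - x i \<and> col (x j - x i) = c i j)"
        using x u(1) by (intro exI[of _ "case_nat u x"]) (auto simp: W_def less_Suc_eq_0_disj split: nat.splits)
    qed
  qed
qed

section \<open>From a primitive root to a difference family\<close>

text \<open>\<open>R\<close> is half of the subgroup of index \<open>f\<close>, one element from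
  each pair \<open>x\<close>, \<open>- x\<close>. With \<open>M = (p - 1) div (2 * f)\<close>, that
  subgroup consists of the powers \<open>g ^ (f * j)\<close> with \<open>j < 2 * M\<close>. It
  contains \<open>- 1 = g ^ (f * M)\<close>, which is where the factor 2 in
  \<open>2 * f dvd p - 1\<close> enters.\<close>

lemma residue_colouring_exists:
  fixes p f :: nat
  assumes p: "prime p" and dv: "2 * f dvd p - 1" and f0: "f > 0"
  shows "\<exists>col R. residue_colouring (int p) f col \<and> R \<subseteq> {0..<int p} \<and> card R * (2 * f) = p - 1 \<and>
           (\<forall>r\<in>R. \<not> int p dvd r \<and> col r = 0) \<and>
           (\<forall>x. \<not> int p dvd x \<and> col x = 0 \<longrightarrow> (\<exists>r\<in>R. [x = r] (mod int p) \<or> [x = - r] (mod int p)))"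
proof -
  have p1: "p > 1" using p prime_gt_1_nat by blast
  obtain g where g: "residue_primroot p g" using prime_primitive_root_exists[OF p1] p by blast
  have ordg: "ord p g = p - 1" "coprime p g" using g p by (auto simp: residue_primroot_def totient_prime)
  have gen: "bij_betw (\<lambda>i. g ^ i mod p) {..<p - 1} {0<..<p}"
    using residue_primroot_is_generator[OF p1 g] p
    by (simp add: totient_prime totatives_prime)
  define M where "M = (p - 1) div (2 * f)"
  have M: "M * (2 * f) = p - 1" using dv by (simp add: M_def)
  \<comment> \<open>Exponents of \<open>g\<close> matter only modulo \<open>p - 1\<close>; since
    \<open>f\<close> divides it, they have a well-defined residue modulo \<open>f\<close>.\<close>
  have f_dvd: "f dvd p - 1" using M by (metis dvd_mult_left dvd_triv_right mult.assoc mult.commute)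
  define G where "G l = int (g ^ l mod p)" for l
  have Gc: "[G l = int g ^ l] (mod int p)" for l
    unfolding G_def by (simp add: of_nat_mod cong_def)
  have G_eq: "[G l = G m] (mod int p) \<longleftrightarrow> [l = m] (mod (p - 1))" for l m
  proof -
    have "[G l = G m] (mod int p) \<longleftrightarrow> [g ^ l = g ^ m] (mod p)"
      unfolding G_def cong_int_iff by (simp add: cong_def)
    also have "\<dots> \<longleftrightarrow> [l = m] (mod (p - 1))"
      using order_divides_expdiff[of p g l m] ordg by simp
    finally show ?thesis .
  qed
  have G_mult: "[G (l + m) = G l * G m] (mod int p)" for l m
    using cong_trans[OF Gc[of "l + m", unfolded power_add] cong_sym[OF cong_mult[OF Gc[of l] Gc[of m]]]]
    by (simp add: power_add)
  have G_nd: "\<not> int p dvd G l" for l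
  proof -
    have "\<not> p dvd g" using ordg(2) p1 by (metis coprime_absorb_left nat_dvd_1_iff_1 less_irrefl)
    then have "\<not> int p dvd int g ^ l" using p prime_dvd_power_nat_iff
      by (metis of_nat_dvd_iff of_nat_power prime_dvd_power)
    then show ?thesis using cong_dvd_iff[OF Gc] by blast
  qed
  have G_range: "G l \<in> {0..<int p}" for l using p1 by (simp add: G_def)
  define ix where "ix x = (SOME l. l < p - 1 \<and> [x = G l] (mod int p))" for x
  have ix: "ix x < p - 1 \<and> [x = G (ix x)] (mod int p)" if "\<not> int p dvd x" for x
  proof -
    have "x mod int p \<noteq> 0" "0 \<le> x mod int p" "x mod int p < int p" using that p1 by (auto simp: mod_eq_0_iff_dvd)
    then have "nat (x mod int p) \<in> {0<..<p}" by (simp add: nat_less_iff)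
    then obtain l where "l < p - 1" "nat (x mod int p) = g ^ l mod p"
      using gen unfolding bij_betw_def by (metis (no_types, lifting) imageE lessThan_iff)
    then have "l < p - 1 \<and> x mod int p = G l" using \<open>0 \<le> x mod int p\<close> by (metis G_def nat_0_le)
    then have "\<exists>l. l < p - 1 \<and> [x = G l] (mod int p)" by (metis cong_mod_right cong_refl cong_sym)
    then show ?thesis unfolding ix_def by (rule someI_ex)
  qed
  define col where "col x = ix x mod f" for x
  have ixG: "[ix x = l] (mod f)" if "[x = G l] (mod int p)" for x l
  proof -
    have nd: "\<not> int p dvd x" using that G_nd cong_dvd_iff by blast
    have "[G (ix x) = G l] (mod int p)" using ix[OF nd] that by (meson cong_sym cong_trans)
    then have "[ix x = l] (mod (p - 1))" using G_eq by simp
    then show ?thesis using f_dvd cong_dvd_modulus_nat by blast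
  qed
  have colG: "col (G l) = l mod f" for l
    using ixG[of "G l" l] by (simp add: col_def cong_def)
  have col_cong: "col x = col y" if "[x = y] (mod int p)" for x y
  proof -
    have "[x = G l] (mod int p) \<longleftrightarrow> [y = G l] (mod int p)" for l
      using that by (meson cong_sym cong_trans)
    then show ?thesis by (simp add: col_def ix_def)
  qed
  have col_mult: "col (x * y) = (col x + col y) mod f" if "\<not> int p dvd x" "\<not> int p dvd y" for x y
  proof -
    have "[x * y = G (ix x) * G (ix y)] (mod int p)" using ix that by (intro cong_mult) auto
    then have "[x * y = G (ix x + ix y)] (mod int p)" using G_mult by (meson cong_sym cong_trans)
    then have "col (x * y) = col (G (ix x + ix y))" by (rule col_cong)
    then show ?thesis by (simp add: colG, simp add: col_def mod_add_eq)
  qed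
  have inj: "inj_on G {..<p - 1}"
  proof (rule inj_onI)
    fix l m assume lm: "l \<in> {..<p - 1}" "m \<in> {..<p - 1}" "G l = G m"
    then have "[l = m] (mod (p - 1))" using G_eq cong_refl by metis
    then show "l = m" using lm by (simp add: cong_def)
  qed
  have card_class: "int (card {x\<in>{0..<int p}. \<not> int p dvd x \<and> col x = c} * f) = int p - 1" if "c < f" for c
  proof -
    have "{x\<in>{0..<int p}. \<not> int p dvd x \<and> col x = c} = G ` (\<lambda>j. c + f * j) ` {..<2 * M}" (is "?A = ?B")
    proof (intro equalityI subsetI)
      fix x assume x: "x \<in> ?A"
      then have l: "ix x < p - 1" "[x = G (ix x)] (mod int p)" using ix by auto
      have "x = G (ix x)" using l(2) x G_range[of "ix x"] by (simp add: cong_def)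
      moreover have "ix x = c + f * (ix x div f)"
        using x by (auto simp: col_def)
      moreover have "ix x div f < 2 * M" using l(1) M f0 by (simp add: less_mult_imp_div_less mult.commute mult.left_commute)
      ultimately show "x \<in> ?B" by blast
    next
      fix x assume "x \<in> ?B"
      then obtain j where "x = G (c + f * j)" by auto
      then show "x \<in> ?A" using G_range G_nd that colG by auto
    qed
    moreover have "card ?B = card ((\<lambda>j. c + f * j) ` {..<2 * M})"
    proof (rule card_image, rule inj_on_subset[OF inj], clarsimp)
      fix j assume "j < 2 * M"
      then have "f * (j + 1) \<le> f * (2 * M)" by (intro mult_left_mono) auto
      then have "f * j + f \<le> p - 1" using M by (simp add: algebra_simps)
      then show "c + f * j < p - Suc 0" using that by simp
    qed
    moreover have "card ((\<lambda>j. c + f * j) ` {..<2 * M}) = 2 * M"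
      using f0 by (subst card_image) (auto simp: inj_on_def)
    ultimately have "card ?A * f = p - 1" using M by (simp add: algebra_simps)
    then show ?thesis using p1 by (simp add: of_nat_diff)
  qed
  have rc: "residue_colouring (int p) f col"
  proof
    show "col x < f" for x using f0 by (simp add: col_def)
  qed (use p f0 col_cong col_mult card_class in auto)
  define R where "R = (\<lambda>j. G (f * j)) ` {..<M}"
  have MM: "f * j < p - 1" if "j < M" for j
  proof -
    have "f * j < f * M" using that f0 by simp
    also have "\<dots> \<le> p - 1" using M[symmetric] by simp
    finally show ?thesis .
  qed
  have "inj_on (\<lambda>j. G (f * j)) {..<M}"
  proof (rule inj_onI)
    fix i j assume "i \<in> {..<M}" "j \<in> {..<M}" "G (f * i) = G (f * j)"
    then have "f * i = f * j" using inj_onD[OF inj, of "f * i" "f * j"] MM by simp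
    then show "i = j" using f0 by simp
  qed
  then have cardR: "card R * (2 * f) = p - 1" using M by (simp add: R_def card_image)
  \<comment> \<open>The square of \<open>G (f * M)\<close> is 1, because
    \<open>2 * (f * M) = p - 1\<close>, and it is not 1 itself, because
    \<open>0 < f * M < p - 1\<close>.\<close>
  have minus1: "[G (f * M) = - 1] (mod int p)"
  proof -
    have "[G (f * M) * G (f * M) = G (f * M + f * M)] (mod int p)" using G_mult cong_sym by blast
    moreover have "[G (f * M + f * M) = G 0] (mod int p)"
    proof -
      have "f * M + f * M = p - 1" using M by (simp add: algebra_simps)
      then show ?thesis unfolding G_eq by (simp add: cong_def)
    qed
    moreover have "[G 0 = 1] (mod int p)" using Gc[of 0] by simp
    ultimately have "[G (f * M) * G (f * M) = 1] (mod int p)" using cong_trans by blast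
    then have "int p dvd (G (f * M) - 1) * (G (f * M) + 1)" by (simp add: cong_iff_dvd_diff algebra_simps)
    then have "int p dvd G (f * M) - 1 \<or> int p dvd G (f * M) + 1" using p prime_dvd_mult_iff by (metis prime_nat_int_transfer)
    moreover have "\<not> int p dvd G (f * M) - 1"
    proof
      assume "int p dvd G (f * M) - 1"
      then have "[G (f * M) = 1] (mod int p)" by (simp add: cong_iff_dvd_diff)
      then have "[G (f * M) = G 0] (mod int p)" using \<open>[G 0 = 1] (mod int p)\<close> by (meson cong_sym cong_trans)
      then have "[f * M = 0] (mod (p - 1))" using G_eq by simp
      then have "p - 1 dvd f * M" by (simp add: cong_0_iff)
      moreover have "f * M > 0" using M p1 f0 by (cases M) auto
      ultimately have "p - 1 \<le> f * M" by (simp add: dvd_imp_le)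
      moreover have "2 * (f * M) = p - 1" using M by (simp add: algebra_simps)
      ultimately show False using \<open>f * M > 0\<close> by linarith
    qed
    ultimately show ?thesis by (simp add: cong_iff_dvd_diff)
  qed
  have half: "\<exists>r\<in>R. [x = r] (mod int p) \<or> [x = - r] (mod int p)" if x: "\<not> int p dvd x" "col x = 0" for x
  proof -
    have l: "ix x < p - 1" "[x = G (ix x)] (mod int p)" using ix x by auto
    obtain j where j: "ix x = f * j" using x(2) by (auto simp: col_def)
    then have "f * j < f * (2 * M)" using l(1) M by (simp add: algebra_simps)
    then have "j < 2 * M" by simp
    show ?thesis
    proof (cases "j < M")
      case True
      then show ?thesis using l j by (auto simp: R_def)
    next
      case False
      then have jj: "j - M < M" "f * j = f * M + f * (j - M)" using \<open>j < 2 * M\<close> by (auto simp flip: distrib_left)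
      have "[x = G (f * M) * G (f * (j - M))] (mod int p)"
        using l(2) G_mult[of "f * M" "f * (j - M)"] j jj(2) by (metis cong_trans)
      moreover have "[G (f * M) * G (f * (j - M)) = - 1 * G (f * (j - M))] (mod int p)"
        by (intro cong_mult minus1 cong_refl)
      ultimately have "[x = - 1 * G (f * (j - M))] (mod int p)" using cong_trans by blast
      then show ?thesis using jj(1) by (auto simp: R_def)
    qed
  qed
  show ?thesis
    using rc cardR half G_range G_nd colG by (intro exI[of _ col] exI[of _ R]) (auto simp: R_def)
qed

text \<open>The blocks \<open>{r * b 0, \<dots>, r * b (k - 1)}\<close> with \<open>r \<in> R\<close> form the family. Every nonzero residue is a
  difference at least once, hence exactly once by the cardinality condition.\<close>

definition disjoint_difference_family :: "int \<Rightarrow> nat \<Rightarrow> int set \<Rightarrow> (nat \<Rightarrow> int) \<Rightarrow> bool" where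
  "disjoint_difference_family p k R b \<longleftrightarrow>
     R \<subseteq> {0..<p} \<and> int (card R * (k * (k - 1))) = p - 1 \<and>
     (\<forall>d. \<not> p dvd d \<longrightarrow> (\<exists>r\<in>R. \<exists>i<k. \<exists>j<k. [d = r * (b i - b j)] (mod p))) \<and>
     (\<forall>r\<in>R. \<forall>s\<in>R. \<forall>i<k. \<forall>j<k. [r * b i = s * b j] (mod p) \<longrightarrow> r = s \<and> i = j)"

text \<open>\<open>f\<close> is the number of pairs \<open>i < j\<close>, and each pair gets its own
  colour, so the differences \<open>b j - b i\<close> represent all cosets of the subgroup of index
  \<open>f\<close>. Multiplied by the subgroup, which is \<open>R\<close> together with its
  negatives, they reach every nonzero residue. In addition \<open>b i\<close> has colour
  \<open>i\<close>, and multiplication by elements of \<open>R\<close>, of colour 0, preserves it,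
  so the blocks are disjoint.\<close>

lemma disjoint_difference_family_exists:
  fixes k :: nat
  assumes k: "k \<ge> 3"
  shows "\<exists>p0. \<forall>p. prime p \<and> p \<ge> p0 \<and> k * (k - 1) dvd p - 1 \<longrightarrow>
    (\<exists>R b. disjoint_difference_family (int p) k R b)"
proof -
  define f where "f = k * (k - 1) div 2"
  have f2: "2 * f = k * (k - 1)" unfolding f_def by (cases "even k") auto
  \<comment> \<open>Here \<open>k \<ge> 3\<close> supplies at least \<open>k\<close> colours, enough
    to give the \<open>b i\<close> different ones.\<close>
  have "k * 2 \<le> k * (k - 1)" using k by (intro mult_le_mono2) simp
  then have fk: "k \<le> f" using f2 by linarith
  then have f0: "f > 0" using k by simp
  define pairs where "pairs = {(i, j). i < j \<and> j < k}"
  have cardp: "card pairs = f" and finp: "finite pairs"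
  proof -
    have "pairs = (\<lambda>(j, i). (i, j)) ` Sigma {..<k} (\<lambda>j. {..<j})" by (auto simp: pairs_def)
    then have "card pairs = card (Sigma {..<k} (\<lambda>j. {..<j}))"
      by (simp add: card_image inj_on_def split_beta prod_eq_iff)
    also have "\<dots> = \<Sum>{..<k}" by simp
    also have "\<dots> = f" unfolding f_def by (simp add: Sum_Ico_nat lessThan_atLeast0)
    finally show "card pairs = f" .
    then show "finite pairs" using f0 by (metis card.infinite less_irrefl)
  qed
  obtain h where h: "bij_betw h pairs {..<f}" using ex_bij_betw_finite_nat[OF finp] cardp lessThan_atLeast0 by metis
  define c where "c i j = (if (i, j) \<in> pairs then h (i, j) else 0)" for i j
  have cf: "c i j < f" for i j using h f0 by (auto simp: c_def bij_betw_def)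
  \<comment> \<open>A colour class has \<open>(p - 1) / f\<close> elements, which is at least
    \<open>p / (2 * f)\<close>.\<close>
  define \<epsilon> where "\<epsilon> = 1 / (2 * real f)"
  have "\<epsilon> > 0" using f0 by (simp add: \<epsilon>_def)
  from prescribed_difference_colours[OF this, where n = k and f = f] obtain p0 where
    p0: "\<And>p col V c. residue_colouring p f col \<Longrightarrow> p \<ge> p0 \<Longrightarrow>
      (\<forall>i<k. V i \<subseteq> {0..<p} \<and> real (card (V i)) \<ge> \<epsilon> * p) \<Longrightarrow> (\<forall>i j. c i j < f) \<Longrightarrow>
      (\<exists>x. (\<forall>i<k. x i \<in> V i) \<and>
           (\<forall>j<k. \<forall>i<j. \<not> p dvd x j - x i \<and> col (x j - x i) = c i j))" by blast
  show ?thesis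
  proof (rule exI[of _ "nat p0"], intro allI impI)
    fix p :: nat assume pp: "prime p \<and> p \<ge> nat p0 \<and> k * (k - 1) dvd p - 1"
    obtain col R where rc: "residue_colouring (int p) f col" and R: "R \<subseteq> {0..<int p}" "card R * (2 * f) = p - 1"
           "\<And>r. r \<in> R \<Longrightarrow> \<not> int p dvd r \<and> col r = 0"
           "\<And>x. \<not> int p dvd x \<Longrightarrow> col x = 0 \<Longrightarrow> (\<exists>r\<in>R. [x = r] (mod int p) \<or> [x = - r] (mod int p))"
      using residue_colouring_exists[of p f] pp f0 f2 by auto
    interpret residue_colouring "int p" f col by fact
    have p2: "p \<ge> 2" using pp prime_ge_2_nat by blast
    define V where "V i = {x\<in>{0..<int p}. \<not> int p dvd x \<and> col x = i}" for i
    have "real (card (V i)) \<ge> \<epsilon> * p" if "i < k" for i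
    proof -
      have "int (card (V i) * f) = int p - 1" using card_class[of i] that fk by (simp add: V_def)
      then have "real (card (V i)) * f = real p - 1"
        by (metis of_int_diff of_int_of_nat_eq of_int_1 of_nat_mult)
      then show ?thesis using f0 p2 by (simp add: \<epsilon>_def field_simps)
    qed
    then have "\<forall>i<k. V i \<subseteq> {0..<int p} \<and> real (card (V i)) \<ge> \<epsilon> * real_of_int (int p)"
      by (auto simp: V_def)
    moreover have "int p \<ge> p0" using pp by linarith
    ultimately obtain b where b: "\<forall>i<k. b i \<in> V i"
      "\<forall>j<k. \<forall>i<j. \<not> int p dvd b j - b i \<and> col (b j - b i) = c i j"
      using p0[OF rc, of V c] cf by blast
    have bi: "\<not> int p dvd b i" "col (b i) = i" if "i < k" for i using b(1) that by (auto simp: V_def)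
    have pint: "prime (int p)" using pp by simp
    have cover: "\<exists>r\<in>R. \<exists>i<k. \<exists>j<k. [d = r * (b i - b j)] (mod int p)" if d: "\<not> int p dvd d" for d
    proof -
      have "col d \<in> {..<f}" using col_less by simp
      then obtain i j where ij: "(i, j) \<in> pairs" "h (i, j) = col d"
        using h unfolding bij_betw_def by (metis (no_types, lifting) imageE surj_pair)
      then have ij': "i < j" "j < k" by (auto simp: pairs_def)
      define y where "y = b j - b i"
      have y: "\<not> int p dvd y" "col y = col d" using b(2) ij ij' by (auto simp: y_def c_def)
      \<comment> \<open>Dividing \<open>d\<close> by the difference \<open>y\<close> of the same
        colour leaves a quotient of colour 0, which is an element of \<open>R\<close> up to sign;
        the sign only decides the order of \<open>i\<close> and \<open>j\<close>.\<close>
      have "coprime y (int p)" using y(1) pint by (metis coprime_commute prime_imp_coprime)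
      then obtain z where z: "[y * z = 1] (mod int p)" using cong_solve_coprime_int by blast
      have zd: "[y * (z * d) = d] (mod int p)" using cong_scalar_right[OF z, of d] by (simp add: mult.assoc)
      have nd: "\<not> int p dvd z * d" using zd d cong_dvd_iff[OF zd] by auto
      have "col d = (col y + col (z * d)) mod f"
        using col_cong[OF zd] col_mult[OF y(1) nd] by simp
      then have "[col d + 0 = col d + col (z * d)] (mod f)"
        using y(2) col_less[of d] by (simp add: cong_def)
      then have "col (z * d) = 0" using col_less[of "z * d"]
        by (metis cong_add_lcancel_nat cong_less_modulus_unique_nat f_pos)
      then obtain r where r: "r \<in> R" "[z * d = r] (mod int p) \<or> [z * d = - r] (mod int p)" using R(4)[OF nd] by blast
      from r(2) show ?thesis
      proof
        assume "[z * d = r] (mod int p)"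
        then have "[y * (z * d) = y * r] (mod int p)" by (intro cong_mult cong_refl)
        then have "[d = r * (b j - b i)] (mod int p)" using zd unfolding y_def
          by (metis cong_sym cong_trans mult.commute)
        then show ?thesis using r ij' by (meson less_trans)
      next
        assume "[z * d = - r] (mod int p)"
        then have "[y * (z * d) = y * (- r)] (mod int p)" by (intro cong_mult cong_refl)
        moreover have "y * (- r) = r * (b i - b j)" by (simp add: y_def algebra_simps)
        ultimately have "[d = r * (b i - b j)] (mod int p)" using zd by (metis cong_sym cong_trans)
        then show ?thesis using r ij' by (meson less_trans)
      qed
    qed
    have rb: "col (r * b i) = i" if "r \<in> R" "i < k" for r i
      using R(3)[OF that(1)] bi[OF that(2)] that fk col_mult[of r "b i"] by simp
    have uniq: "r = s \<and> i = j" if "r \<in> R" "s \<in> R" "i < k" "j < k" and eq: "[r * b i = s * b j] (mod int p)" for r s i j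
    proof -
      have ij: "i = j" using col_cong[OF eq] rb that by simp
      then have "int p dvd (r - s) * b i" using eq by (simp add: cong_iff_dvd_diff left_diff_distrib)
      then have "int p dvd r - s" using bi[OF that(3)] pint by (simp add: prime_dvd_mult_iff)
      then have "r = s" using R(1) that by (metis atLeastLessThan_iff mod_eq_dvd_iff mod_pos_pos_trivial subsetD)
      then show ?thesis using ij by simp
    qed
    have "int (card R * (k * (k - 1))) = int p - 1"
      using R(2) f2 p2 by (simp add: of_nat_diff)
    then show "\<exists>R b. disjoint_difference_family (int p) k R b"
      using R(1) cover uniq unfolding disjoint_difference_family_def
      by (intro exI[of _ R] exI[of _ b]) auto
  qed
qed

section \<open>Factors and tournaments\<close>

text \<open>An overlap of two of the sets would be counted twice in the sum. This serves both for
  the blocks of a round and for the edge sets of the rounds, where only covering and counting then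
  remain to be checked.\<close>

lemma disjoint_if_sum_card_le_card_UN:
  assumes I: "finite I" and fin: "\<And>i. i \<in> I \<Longrightarrow> finite (A i)"
    and le: "(\<Sum>i\<in>I. card (A i)) \<le> card (\<Union>i\<in>I. A i)"
    and ij: "i \<in> I" "j \<in> I" "i \<noteq> j"
  shows "A i \<inter> A j = {}"
proof (rule ccontr)
  assume ne: "A i \<inter> A j \<noteq> {}"
  define J where "J = I - {i, j}"
  have I_eq: "I = insert i (insert j J)" "i \<notin> insert j J" "j \<notin> J" "finite J"
    using ij I by (auto simp: J_def)
  have "card (\<Union>i\<in>I. A i) = card ((A i \<union> A j) \<union> (\<Union>l\<in>J. A l))"
    by (rule arg_cong[where f = card]) (auto simp: I_eq(1))
  also have "\<dots> \<le> card (A i \<union> A j) + card (\<Union>l\<in>J. A l)" by (rule card_Un_le)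
  also have "\<dots> \<le> card (A i \<union> A j) + (\<Sum>l\<in>J. card (A l))"
    using card_UN_le[OF I_eq(4)] by simp
  also have "card (A i \<union> A j) + card (A i \<inter> A j) = card (A i) + card (A j)"
    using fin ij card_Un_Int by metis
  moreover have "card (A i \<inter> A j) > 0" using ne fin ij by (simp add: card_gt_0_iff)
  ultimately have "card (\<Union>i\<in>I. A i) < card (A i) + card (A j) + (\<Sum>l\<in>J. card (A l))" by linarith
  also have "\<dots> = (\<Sum>l\<in>I. card (A l))" using I_eq by simp
  finally show False using le by simp
qed

lemma partition_on_if_cover:
  assumes V: "finite V" and F: "finite F" "\<Union>F = V" and k: "k > 0"
    and card: "\<And>B. B \<in> F \<Longrightarrow> card B = k" and le: "card F * k \<le> card V"
  shows "partition_on V F"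
proof (rule partition_onI)
  fix B C assume BC: "B \<in> F" "C \<in> F" "B \<noteq> C"
  have "B \<inter> C = {}"
    using disjoint_if_sum_card_le_card_UN[of F id B C] F V BC card le
    by (auto intro: finite_subset)
  then show "disjnt B C" by (simp add: disjnt_def)
next
  show "{} \<notin> F" using card k by force
qed (use F in auto)

lemma Kk_factorI:
  assumes "finite V" "finite F" "\<Union>F = V" "k > 0"
    "\<And>B. B \<in> F \<Longrightarrow> card B = k" "card F * k \<le> card V"
  shows "is_Kk_factor k V (nsets V 2) F"
proof -
  have "partition_on V F" using assms by (intro partition_on_if_cover)
  moreover have "finite B \<and> card B = k \<and> nsets B 2 \<subseteq> nsets V 2" if "B \<in> F" for B
    using assms that by (auto simp: nsets_def intro: finite_subset)
  ultimately show ?thesis unfolding is_Kk_factor_def by blast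
qed

lemma card_Kk_factor:
  assumes "is_Kk_factor k V E F" "finite V"
  shows "card F * k = card V"
proof -
  have F: "partition_on V F" "\<And>B. B \<in> F \<Longrightarrow> finite B \<and> card B = k"
    using assms by (auto simp: is_Kk_factor_def)
  have "card V = card (\<Union>F)" using F by (simp add: partition_on_def)
  also have "\<dots> = (\<Sum>B\<in>F. card B)"
    using F by (intro card_Union_disjoint) (auto simp: partition_on_def disjoint_def pairwise_def disjnt_def)
  finally show ?thesis using F by simp
qed

text \<open>A round has \<open>card V * (k - 1) / 2\<close> edges, so at most
  \<open>(card V - 1) / (k - 1)\<close> rounds have no more edges altogether than the complete
  graph. If they cover it, no edge is used twice.\<close>

lemma is_tournament_if_cover:
  assumes V: "finite V" and factor: "\<And>H. H \<in> set Hs \<Longrightarrow> is_Kk_factor k V (nsets V 2) H"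
    and cover: "nsets V 2 \<subseteq> (\<Union>H\<in>set Hs. factor_edges H)"
    and le: "length Hs * (k - 1) \<le> card V - 1"
  shows "is_tournament k V Hs"
proof -
  have fe: "factor_edges H \<subseteq> nsets V 2" if "H \<in> set Hs" for H
    using factor[OF that] by (auto simp: is_Kk_factor_def factor_edges_def)
  have finV2: "finite (nsets V 2)" using V by (rule finite_imp_finite_nsets)
  have ce: "2 * card (factor_edges H) \<le> card V * (k - 1)" if "H \<in> set Hs" for H
  proof -
    have H: "is_Kk_factor k V (nsets V 2) H" using factor that .
    have "finite H" using H V finite_elements by (auto simp: is_Kk_factor_def)
    then have "card (factor_edges H) \<le> (\<Sum>B\<in>H. card (nsets B 2))"
      unfolding factor_edges_def by (rule card_UN_le)
    also have "\<dots> = (\<Sum>B\<in>H. k choose 2)"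
      using H by (intro sum.cong) (auto simp: is_Kk_factor_def card_nsets)
    also have "\<dots> = card H * (k choose 2)" by simp
    finally have "2 * card (factor_edges H) \<le> card H * (2 * (k choose 2))" by simp
    also have "2 * (k choose 2) = k * (k - 1)" by (cases "even k") (auto simp: choose_two)
    also have "card H * (k * (k - 1)) = card V * (k - 1)" using card_Kk_factor[OF H V] by (metis mult.assoc)
    finally show ?thesis .
  qed
  have union: "(\<Union>i<length Hs. factor_edges (Hs ! i)) = nsets V 2"
    using cover fe by (fastforce simp: set_conv_nth)
  have "2 * (\<Sum>i<length Hs. card (factor_edges (Hs ! i))) \<le> (\<Sum>i<length Hs. card V * (k - 1))"
    unfolding sum_distrib_left using ce by (intro sum_mono) auto
  also have "\<dots> = card V * (length Hs * (k - 1))" by simp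
  also have "\<dots> \<le> card V * (card V - 1)" using le by simp
  also have "\<dots> = 2 * card (nsets V 2)" using V by (cases "even (card V)") (auto simp: card_nsets choose_two)
  finally have sle: "(\<Sum>i<length Hs. card (factor_edges (Hs ! i))) \<le> card (\<Union>i<length Hs. factor_edges (Hs ! i))"
    using union by simp
  have "factor_edges (Hs ! i) \<inter> factor_edges (Hs ! j) = {}" if "i < length Hs" "j < length Hs" "i \<noteq> j" for i j
  proof (rule disjoint_if_sum_card_le_card_UN[OF _ _ sle])
    show "finite (factor_edges (Hs ! l))" if "l \<in> {..<length Hs}" for l
      using fe[of "Hs ! l"] finV2 that by (auto intro: finite_subset)
  qed (use that in auto)
  then show ?thesis unfolding is_tournament_def using factor by blast
qed

text \<open>Two players of \<open>A\<close> cannot share a block of an extension, since their edge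
  is already used. So the blocks chosen by \<open>g\<close> are distinct, whereas a factor has only
  \<open>card V / k\<close> blocks.\<close>

lemma not_extendable_if_clique:
  assumes V: "finite V" and A: "A \<subseteq> V" and k: "k > 0"
    and cover: "nsets A 2 \<subseteq> (\<Union>H\<in>set Hs. factor_edges H)"
    and large: "card V < card A * k"
  shows "\<not> can_be_extended k V Hs"
proof
  assume "can_be_extended k V Hs"
  then obtain F where F: "is_Kk_factor k V (feasibility_graph V Hs) F" by (auto simp: can_be_extended_def)
  then have part: "partition_on V F" by (simp add: is_Kk_factor_def)
  then have finF: "finite F" using V finite_elements by blast
  have "\<forall>x\<in>A. \<exists>B\<in>F. x \<in> B" using part A by (auto simp: partition_on_def)
  then obtain g where g: "\<And>x. x \<in> A \<Longrightarrow> g x \<in> F \<and> x \<in> g x" by metis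
  have "inj_on g A"
  proof (rule inj_onI, rule ccontr)
    fix x y assume xy: "x \<in> A" "y \<in> A" "g x = g y" "x \<noteq> y"
    then have "{x, y} \<in> nsets (g x) 2" "{x, y} \<in> nsets A 2" using g by (auto simp: nsets_def)
    moreover have "nsets (g x) 2 \<subseteq> feasibility_graph V Hs" using F g xy by (auto simp: is_Kk_factor_def)
    ultimately have "{x, y} \<in> feasibility_graph V Hs" "{x, y} \<in> (\<Union>H\<in>set Hs. factor_edges H)"
      using cover by blast+
    then show False unfolding feasibility_graph_def by blast
  qed
  then have "card A \<le> card F" using g finF by (intro card_inj_on_le[of g]) auto
  then have "card A * k \<le> card V" using card_Kk_factor[OF F V] by (metis mult_le_mono1)
  then show False using large by simp
qed

section \<open>Relabelling the players and joining two tournaments\<close>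

lemma nsets_image:
  assumes "inj_on g B"
  shows "nsets (g ` B) 2 = (`) g ` nsets B 2"
proof (intro equalityI subsetI)
  fix e assume "e \<in> nsets (g ` B) 2"
  then obtain X where X: "X \<subseteq> B" "e = g ` X" "finite e" "card e = 2"
    by (auto simp: nsets_def subset_image_iff)
  moreover have "inj_on g X" using assms X inj_on_subset by blast
  ultimately show "e \<in> (`) g ` nsets B 2"
    by (auto simp: nsets_def card_image finite_image_iff intro!: imageI)
next
  fix e assume "e \<in> (`) g ` nsets B 2"
  then obtain X where X: "X \<subseteq> B" "e = g ` X" "finite X" "card X = 2" by (auto simp: nsets_def)
  moreover have "inj_on g X" using assms X inj_on_subset by blast
  ultimately show "e \<in> nsets (g ` B) 2" by (auto simp: nsets_def card_image)
qed

lemma factor_edges_image: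
  assumes "\<And>B. B \<in> H \<Longrightarrow> B \<subseteq> V" "inj_on g V"
  shows "factor_edges ((`) g ` H) = (`) g ` factor_edges H"
proof -
  have "nsets (g ` B) 2 = (`) g ` nsets B 2" if "B \<in> H" for B
    using assms that by (intro nsets_image) (auto intro: inj_on_subset)
  then show ?thesis by (auto simp: factor_edges_def)
qed

lemma Kk_factor_image:
  assumes H: "is_Kk_factor k V (nsets V 2) H" and g: "inj_on g V"
  shows "is_Kk_factor k (g ` V) (nsets (g ` V) 2) ((`) g ` H)"
proof -
  have part: "partition_on V H" and blk: "\<And>B. B \<in> H \<Longrightarrow> finite B \<and> card B = k"
    using H by (auto simp: is_Kk_factor_def)
  then have sub: "\<And>B. B \<in> H \<Longrightarrow> B \<subseteq> V" by (auto simp: partition_on_def)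
  have "{} \<notin> (`) g ` H" using part by (auto simp: partition_on_def)
  then have "partition_on (g ` V) ((`) g ` H)"
    using partition_on_inj_image[OF part g] by simp
  moreover have "finite X \<and> card X = k \<and> nsets X 2 \<subseteq> nsets (g ` V) 2" if X: "X \<in> (`) g ` H" for X
  proof -
    obtain B where B: "B \<in> H" "X = g ` B" using X by auto
    then have "inj_on g B" using sub g inj_on_subset by blast
    moreover have "g ` B \<subseteq> g ` V" using sub[OF B(1)] by (rule image_mono)
    ultimately show ?thesis using B blk by (auto simp: card_image nsets_def)
  qed
  ultimately show ?thesis by (auto simp: is_Kk_factor_def)
qed

lemma is_tournament_image:
  assumes T: "is_tournament k V Hs" and g: "inj_on g V"
  shows "is_tournament k (g ` V) (map ((`) ((`) g)) Hs)"
proof -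
  have fac: "\<And>H. H \<in> set Hs \<Longrightarrow> is_Kk_factor k V (nsets V 2) H"
    and uniq: "\<And>e i j. e \<in> nsets V 2 \<Longrightarrow> i < length Hs \<Longrightarrow> j < length Hs \<Longrightarrow>
        e \<in> factor_edges (Hs ! i) \<Longrightarrow> e \<in> factor_edges (Hs ! j) \<Longrightarrow> i = j"
    using T by (auto simp: is_tournament_def)
  have sub: "B \<subseteq> V" if "H \<in> set Hs" "B \<in> H" for H B
    using fac[OF that(1)] that(2) by (auto simp: is_Kk_factor_def partition_on_def)
  have fe: "factor_edges H \<subseteq> nsets V 2" if "H \<in> set Hs" for H
    using fac[OF that] by (auto simp: is_Kk_factor_def factor_edges_def)
  have img: "factor_edges ((`) g ` H) = (`) g ` factor_edges H" if "H \<in> set Hs" for H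
    using sub[OF that] g by (rule factor_edges_image)
  have "i = j" if ij: "i < length Hs" "j < length Hs"
      "e \<in> (`) g ` factor_edges (Hs ! i)" "e \<in> (`) g ` factor_edges (Hs ! j)" for e i j
  proof -
    obtain X Y where XY: "X \<in> factor_edges (Hs ! i)" "Y \<in> factor_edges (Hs ! j)" "e = g ` X" "e = g ` Y"
      using ij by auto
    then have V2: "X \<in> nsets V 2" "Y \<in> nsets V 2"
      using fe[of "Hs ! i"] fe[of "Hs ! j"] ij by auto
    then have "X \<subseteq> V" "Y \<subseteq> V" by (auto simp: nsets_def)
    then have "X = Y" using XY(3,4) g inj_on_image_eq_iff[of g V X Y] by simp
    then show ?thesis using uniq[OF V2(1) ij(1,2)] XY by simp
  qed
  moreover have "is_Kk_factor k (g ` V) (nsets (g ` V) 2) ((`) g ` H)" if "H \<in> set Hs" for H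
    using Kk_factor_image[OF fac[OF that] g] .
  ultimately show ?thesis unfolding is_tournament_def by (simp add: img)
qed

text \<open>A pair inside \<open>A\<close> is never inside \<open>B\<close>, so each edge of a
  joined round comes from one side only, and the uniqueness of its round is inherited from there.
  Equal lengths let \<open>map2\<close> keep all rounds.\<close>

lemma is_tournament_Un:
  assumes A: "is_tournament k A Ha" and B: "is_tournament k B Hb"
    and disj: "A \<inter> B = {}" and len: "length Ha = length Hb"
  shows "is_tournament k (A \<union> B) (map2 (\<union>) Ha Hb)"
proof -
  define Hs where "Hs = map2 (\<union>) Ha Hb"
  have nth: "Hs ! i = Ha ! i \<union> Hb ! i" if "i < length Ha" for i using that len by (simp add: Hs_def)
  have lHs: "length Hs = length Ha" using len by (simp add: Hs_def)
  have facA: "is_Kk_factor k A (nsets A 2) (Ha ! i)" if "i < length Ha" for i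
    using A that by (auto simp: is_tournament_def)
  have facB: "is_Kk_factor k B (nsets B 2) (Hb ! i)" if "i < length Ha" for i
    using B that len by (auto simp: is_tournament_def)
  have feA: "factor_edges (Ha ! i) \<subseteq> nsets A 2" if "i < length Ha" for i
    using facA[OF that] by (auto simp: is_Kk_factor_def factor_edges_def)
  have feB: "factor_edges (Hb ! i) \<subseteq> nsets B 2" if "i < length Ha" for i
    using facB[OF that] by (auto simp: is_Kk_factor_def factor_edges_def)
  have disj2: "e \<notin> nsets B 2" if "e \<in> nsets A 2" for e
  proof
    assume "e \<in> nsets B 2"
    then have "e \<subseteq> A \<inter> B" "card e = 2" using that by (auto simp: nsets_def)
    then show False using disj by simp
  qed
  have "is_Kk_factor k (A \<union> B) (nsets (A \<union> B) 2) (Ha ! i \<union> Hb ! i)" if i: "i < length Ha" for i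
  proof -
    have "partition_on (A \<union> B) (Ha ! i \<union> Hb ! i)"
    proof -
      have pA: "partition_on A (Ha ! i)" and pB: "partition_on B (Hb ! i)"
        using facA[OF i] facB[OF i] by (auto simp: is_Kk_factor_def)
      have "\<Union> (Ha ! i) \<inter> \<Union> (Hb ! i) = {}"
        using disj partition_onD1[OF pA] partition_onD1[OF pB] by simp
      then have "disjoint (Ha ! i \<union> Hb ! i)"
        using partition_onD2[OF pA] partition_onD2[OF pB] by (intro disjoint_union)
      then show ?thesis using pA pB by (simp add: partition_on_def)
    qed
    moreover have "nsets A 2 \<subseteq> nsets (A \<union> B) 2" "nsets B 2 \<subseteq> nsets (A \<union> B) 2"
      by (auto simp: nsets_def)
    ultimately show ?thesis using facA[OF i] facB[OF i] unfolding is_Kk_factor_def by blast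
  qed
  then have "\<forall>H\<in>set Hs. is_Kk_factor k (A \<union> B) (nsets (A \<union> B) 2) H"
    using nth lHs by (metis in_set_conv_nth)
  moreover have "i = j" if ij: "i < length Hs" "j < length Hs"
    and e: "e \<in> factor_edges (Hs ! i)" "e \<in> factor_edges (Hs ! j)" for e i j
  proof -
    have "factor_edges (X \<union> Y) = factor_edges X \<union> factor_edges Y" for X Y :: "'a set set"
      by (auto simp: factor_edges_def)
    then have ee: "e \<in> factor_edges (Ha ! i) \<or> e \<in> factor_edges (Hb ! i)"
      "e \<in> factor_edges (Ha ! j) \<or> e \<in> factor_edges (Hb ! j)"
      using ij e nth lHs by auto
    show ?thesis
    proof (cases "e \<in> nsets A 2")
      case True
      then have "e \<in> factor_edges (Ha ! i)" "e \<in> factor_edges (Ha ! j)"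
        using ee disj2[OF True] feB[of i] feB[of j] ij lHs by auto
      then show ?thesis using A True ij lHs by (simp add: is_tournament_def)
    next
      case False
      then have "e \<in> factor_edges (Hb ! i)" "e \<in> factor_edges (Hb ! j)"
        using ee feA[of i] feA[of j] False ij lHs by auto
      moreover then have "e \<in> nsets B 2" using feB[of i] ij lHs by auto
      ultimately show ?thesis using B ij lHs len by (simp add: is_tournament_def)
    qed
  qed
  ultimately show ?thesis unfolding is_tournament_def Hs_def by blast
qed

section \<open>Resolvable designs\<close>

text \<open>The line of slope \<open>y\<close> and offset \<open>x\<close>, with one point in each
  of \<open>k\<close> copies of the integers modulo \<open>n\<close>. Copy \<open>i\<close> has
  abscissa \<open>i + 1\<close> rather than \<open>i\<close>, which is invertible modulo a prime
  above \<open>k\<close>; over such a prime, lines of incongruent slopes and equal offset never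
  meet.\<close>

definition line_block :: "int \<Rightarrow> nat \<Rightarrow> int \<Rightarrow> int \<Rightarrow> (nat \<times> int) set" where
  "line_block n k y x = (\<lambda>i. (i, (y * (int i + 1) + x) mod n)) ` {..<k}"

lemma card_line_block: "card (line_block n k y x) = k"
  unfolding line_block_def by (subst card_image) (auto simp: inj_on_def)

lemma line_block_subset: "n > 0 \<Longrightarrow> line_block n k y x \<subseteq> {..<k} \<times> {0..<n}"
  by (auto simp: line_block_def)

lemma mem_line_block:
  "(i, z) \<in> line_block n k y x \<longleftrightarrow> i < k \<and> z = (y * (int i + 1) + x) mod n"
  by (auto simp: line_block_def)

lemma parallel_lines_Kk_factor:
  assumes n: "n > 0" and k: "k > 0"
  shows "is_Kk_factor k ({..<k} \<times> {0..<n}) (nsets ({..<k} \<times> {0..<n}) 2) (line_block n k y ` {0..<n})"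
proof (rule Kk_factorI)
  show "\<Union> (line_block n k y ` {0..<n}) = {..<k} \<times> {0..<n}"
  proof
    show "{..<k} \<times> {0..<n} \<subseteq> \<Union> (line_block n k y ` {0..<n})"
    proof
      fix v assume "v \<in> {..<k} \<times> {0..<n}"
      then obtain i z where v: "v = (i, z)" and iz: "i < k" "0 \<le> z" "z < n" by auto
      define x where "x = (z - y * (int i + 1)) mod n"
      have "(y * (int i + 1) + x) mod n = z mod n" unfolding x_def by (simp add: mod_add_right_eq)
      then have "v \<in> line_block n k y x" using iz v by (simp add: mem_line_block)
      moreover have "x \<in> {0..<n}" using n by (simp add: x_def)
      ultimately show "v \<in> \<Union> (line_block n k y ` {0..<n})" by blast
    qed
  qed (use line_block_subset[OF n] in blast)
  have "card (line_block n k y ` {0..<n}) * k \<le> nat n * k"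
    using card_image_le[of "{0..<n}" "line_block n k y"] by simp
  then show "card (line_block n k y ` {0..<n}) * k \<le> card ({..<k} \<times> {0..<n})"
    by (simp add: card_cartesian_product mult.commute)
qed (use k in \<open>auto simp: card_line_block\<close>)

text \<open>If a line of slope \<open>s\<close> and one of slope \<open>t\<close> share points in
  the copies \<open>i\<close> and \<open>j\<close>, then \<open>n\<close> divides
  \<open>(s - t) * (i - j)\<close>. The condition \<open>sep\<close> forbids this directly, so that
  composite \<open>n\<close> are allowed.\<close>

lemma parallel_lines_tournament:
  fixes n :: int and k r :: nat
  assumes n: "n > 0" and k: "k > 0"
    and sep: "\<And>d s. 0 < d \<Longrightarrow> d < int k \<Longrightarrow> 0 < s \<Longrightarrow> s < int r \<Longrightarrow> \<not> n dvd s * d"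
  shows "is_tournament k ({..<k} \<times> {0..<n}) (map (\<lambda>t. line_block n k (int t) ` {0..<n}) [0..<r])"
proof -
  have "s = t" if st: "s < r" "t < r" and e: "e \<in> nsets ({..<k} \<times> {0..<n}) 2"
    "e \<in> factor_edges (line_block n k (int s) ` {0..<n})"
    "e \<in> factor_edges (line_block n k (int t) ` {0..<n})" for s t e
  proof (rule ccontr)
    assume ne: "s \<noteq> t"
    obtain x y where xy: "e \<subseteq> line_block n k (int s) x" "e \<subseteq> line_block n k (int t) y" and "card e = 2"
      using e by (auto simp: factor_edges_def nsets_def)
    then obtain u v where uv: "e = {u, v}" "u \<noteq> v" by (meson card_2_iff)
    obtain i z j w where [simp]: "u = (i, z)" "v = (j, w)" by fastforce
    have ij: "i < k" "j < k" and z: "z = (int s * (int i + 1) + x) mod n" "z = (int t * (int i + 1) + y) mod n"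
      and w: "w = (int s * (int j + 1) + x) mod n" "w = (int t * (int j + 1) + y) mod n"
      using xy uv by (auto simp: mem_line_block)
    then have "i \<noteq> j" using uv by auto
    have "n dvd (int s * (int i + 1) + x) - (int t * (int i + 1) + y)" using z by (metis mod_eq_dvd_iff)
    moreover have "n dvd (int s * (int j + 1) + x) - (int t * (int j + 1) + y)" using w by (metis mod_eq_dvd_iff)
    ultimately have "n dvd ((int s * (int i + 1) + x) - (int t * (int i + 1) + y)) - ((int s * (int j + 1) + x) - (int t * (int j + 1) + y))"
      by (rule dvd_diff)
    then have "n dvd (int s - int t) * (int i - int j)" by (simp add: algebra_simps)
    then have "n dvd \<bar>int s - int t\<bar> * \<bar>int i - int j\<bar>" by (simp flip: abs_mult)
    moreover have "\<not> n dvd \<bar>int s - int t\<bar> * \<bar>int i - int j\<bar>"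
      using ne \<open>i \<noteq> j\<close> ij st by (intro sep) auto
    ultimately show False by simp
  qed
  then show ?thesis unfolding is_tournament_def using parallel_lines_Kk_factor[OF n k] by auto
qed

text \<open>
  The points are \<open>k\<close> copies of \<open>\<int>/p\<close>. Lines through all copies cover every pair in different copies once;
  the difference family, scaled by \<open>i + 1\<close> on copy \<open>i\<close>, covers every pair inside a copy once. With that scaling
  the base blocks meet exactly the lines \<open>line_block p k y 0\<close> with \<open>y\<close> in the support of the family, so that
  together with the remaining lines through the origin they form a parallel class, which is then translated.
\<close>

lemma resolvable_design_from_difference_family:
  fixes p :: int and k :: nat and R :: "int set" and b :: "nat \<Rightarrow> int"
  assumes p: "prime p" and k: "k \<ge> 2" "int k < p" and Rb: "disjoint_difference_family p k R b"
  shows "\<exists>Hs. is_tournament k ({..<k} \<times> {0..<p}) Hs \<and> length Hs = nat p + k * card R \<and>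
           nsets ({..<k} \<times> {0..<p}) 2 \<subseteq> (\<Union>H\<in>set Hs. factor_edges H)"
proof -
  have R: "R \<subseteq> {0..<p}" and cardR: "int (card R * (k * (k - 1))) = p - 1"
    and diff: "\<And>d. \<not> p dvd d \<Longrightarrow> \<exists>r\<in>R. \<exists>i<k. \<exists>j<k. [d = r * (b i - b j)] (mod p)"
    and disj: "\<And>r s i j. r \<in> R \<Longrightarrow> s \<in> R \<Longrightarrow> i < k \<Longrightarrow> j < k \<Longrightarrow> [r * b i = s * b j] (mod p) \<Longrightarrow> r = s \<and> i = j"
    using Rb unfolding disjoint_difference_family_def by blast+
  define V where "V = {..<k} \<times> {0..<p}"
  have p0: "p > 0" using p prime_gt_0_int by blast
  have finV: "finite V" and cardV: "card V = k * nat p" by (auto simp: V_def card_cartesian_product)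
  have finR: "finite R" using R by (rule finite_subset) simp
  define Q where "Q i r x = (\<lambda>j. (i, ((int i + 1) * (r * b j) + x) mod p)) ` {..<k}" for i :: nat and r x
  define P where "P = (\<lambda>(r, j). r * b j mod p) ` (R \<times> {..<k})"
  have P_sub: "P \<subseteq> {0..<p}" using p0 by (auto simp: P_def)
  have finP: "finite P" using P_sub by (rule finite_subset) simp
  have "inj_on (\<lambda>(r, j). r * b j mod p) (R \<times> {..<k})"
    using disj by (auto simp: inj_on_def cong_def)
  then have cardP: "card P = k * card R" unfolding P_def
    by (subst card_image) (auto simp: card_cartesian_product)
  have unit: "\<not> p dvd int i + 1" if "i < k" for i
    using that k(2) zdvd_imp_le[of p "int i + 1"] by auto
  have solve: "\<exists>y. [c * y = z] (mod p)" if "\<not> p dvd c" for c z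
  proof -
    have "coprime c p" using that p by (metis coprime_commute prime_imp_coprime)
    then obtain u where "[c * u = 1] (mod p)" using cong_solve_coprime_int by blast
    then have "[c * u * z = 1 * z] (mod p)" by (rule cong_scalar_right)
    then show ?thesis by (auto simp: mult.assoc)
  qed
  have Q_card: "card (Q i r x) = k" if ir: "i < k" "r \<in> R" for i r x
  proof -
    have "inj_on (\<lambda>j. (i, ((int i + 1) * (r * b j) + x) mod p)) {..<k}"
    proof (rule inj_onI)
      fix j l assume jl: "j \<in> {..<k}" "l \<in> {..<k}"
        "(i, ((int i + 1) * (r * b j) + x) mod p) = (i, ((int i + 1) * (r * b l) + x) mod p)"
      then have "p dvd ((int i + 1) * (r * b j) + x) - ((int i + 1) * (r * b l) + x)" by (simp add: mod_eq_dvd_iff)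
      then have "p dvd (int i + 1) * (r * b j - r * b l)" by (simp add: algebra_simps)
      then have "p dvd r * b j - r * b l" using unit[OF ir(1)] p prime_dvd_multD by blast
      then show "j = l" using disj[of r r j l] ir jl by (simp add: cong_iff_dvd_diff)
    qed
    then show ?thesis unfolding Q_def by (simp add: card_image)
  qed
  have Q_sub: "Q i r x \<subseteq> V" if "i < k" for i r x
    using that p0 by (auto simp: Q_def V_def)
  have L_sub: "line_block p k y x \<subseteq> V" for y x unfolding V_def using p0 by (rule line_block_subset)
  \<comment> \<open>The class is made of \<open>k * card R\<close> translated base blocks and the
    \<open>p - k * card R\<close> lines of slope outside \<open>P\<close>: together \<open>p\<close>
    blocks, as many as a factor on \<open>k * p\<close> points has.\<close>
  define F where "F x = (\<lambda>(i, r). Q i r x) ` ({..<k} \<times> R) \<union> (\<lambda>y. line_block p k y x) ` ({0..<p} - P)" for x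
  have F: "is_Kk_factor k V (nsets V 2) (F x)" for x
  proof (rule Kk_factorI[OF finV])
    show "finite (F x)" using finR by (simp add: F_def)
    show "k > 0" using k by simp
    show "card B = k" if "B \<in> F x" for B using that Q_card by (auto simp: F_def card_line_block)
    have "card (F x) \<le> card ({..<k} \<times> R) + card ({0..<p} - P)"
      unfolding F_def using finR
      by (intro order.trans[OF card_Un_le] add_mono card_image_le) auto
    also have "card ({0..<p} - P) = nat p - card P" using P_sub finP by (subst card_Diff_subset) auto
    also have "card ({..<k} \<times> R) + (nat p - card P) = nat p"
      using card_mono[OF _ P_sub] by (simp add: card_cartesian_product cardP)
    finally show "card (F x) * k \<le> card V" by (simp add: cardV mult.commute)
    show "\<Union> (F x) = V"
    proof
      show "\<Union> (F x) \<subseteq> V"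
      proof (rule Union_least)
        fix B assume "B \<in> F x"
        then consider i r where "i < k" "B = Q i r x" | y where "B = line_block p k y x"
          unfolding F_def by auto
        then show "B \<subseteq> V" by cases (simp_all add: Q_sub L_sub)
      qed
      show "V \<subseteq> \<Union> (F x)"
      proof
        fix v assume "v \<in> V"
        then obtain i z where v: "v = (i, z)" "i < k" "0 \<le> z" "z < p" by (auto simp: V_def)
        \<comment> \<open>The slope \<open>y\<close> of the line of offset \<open>x\<close> through
          \<open>v\<close> decides which block contains \<open>v\<close>: a base block in copy
          \<open>i\<close> if \<open>y\<close> is in \<open>P\<close>, and that line
          otherwise.\<close>
        obtain y0 where "[(int i + 1) * y0 = z - x] (mod p)" using solve[OF unit[OF v(2)]] by blast
        moreover define y where "y = y0 mod p"
        ultimately have "[(int i + 1) * y = z - x] (mod p)" by (simp add: cong_def mod_mult_right_eq)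
        then have "[(int i + 1) * y + x = z - x + x] (mod p)" by (rule cong_add[OF _ cong_refl])
        then have yz: "((int i + 1) * y + x) mod p = z" using v by (simp add: cong_def)
        have y: "y \<in> {0..<p}" using p0 by (simp add: y_def)
        show "v \<in> \<Union> (F x)"
        proof (cases "y \<in> P")
          case True
          then obtain r j where rj: "r \<in> R" "j < k" "y = r * b j mod p" by (auto simp: P_def)
          then have "((int i + 1) * (r * b j) + x) mod p = z"
            using yz by (metis mod_add_left_eq mod_mult_right_eq)
          then have "v \<in> Q i r x" using v rj by (auto simp: Q_def)
          moreover have "Q i r x \<in> F x" using v rj by (auto simp: F_def)
          ultimately show ?thesis by blast
        next
          case False
          have "v \<in> line_block p k y x" using v yz by (simp add: mem_line_block mult.commute)
          moreover have "line_block p k y x \<in> F x" using False y by (auto simp: F_def)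
          ultimately show ?thesis by blast
        qed
      qed
    qed
  qed
  have E: "is_Kk_factor k V (nsets V 2) (line_block p k y ` {0..<p})" for y
    unfolding V_def using p0 k by (intro parallel_lines_Kk_factor) auto
  obtain ys where ys: "set ys = P" "distinct ys" using finite_distinct_list[OF finP] by blast
  \<comment> \<open>The slopes in \<open>P\<close> are missing from every \<open>F x\<close>; each
    contributes the full parallel class of its lines as one more round.\<close>
  define Hs where "Hs = map (\<lambda>x. F (int x)) [0..<nat p] @ map (\<lambda>y. line_block p k y ` {0..<p}) ys"
  have len: "length Hs = nat p + k * card R"
    using ys distinct_card[of ys] by (simp add: Hs_def cardP)
  have F_in: "F x \<in> set Hs" if "x \<in> {0..<p}" for x
    using that by (auto simp: Hs_def intro!: image_eqI[of _ _ "nat x"])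
  have E_in: "line_block p k y ` {0..<p} \<in> set Hs" if "y \<in> P" for y
    using that ys by (auto simp: Hs_def)
  have covered: "\<exists>H\<in>set Hs. \<exists>B\<in>H. u \<in> B \<and> v \<in> B" if uv: "u \<in> V" "v \<in> V" "u \<noteq> v" for u v
  proof -
    obtain i z where u: "u = (i, z)" "i < k" "0 \<le> z" "z < p" using uv by (auto simp: V_def)
    obtain j w where v: "v = (j, w)" "j < k" "0 \<le> w" "w < p" using uv by (auto simp: V_def)
    show ?thesis
    proof (cases "i = j")
      case True
      then have "z \<noteq> w" using uv u v by auto
      then have zw: "\<not> p dvd z - w" using u v by (metis mod_eq_dvd_iff mod_pos_pos_trivial)
      \<comment> \<open>Undoing the scaling of copy \<open>i\<close> turns \<open>z - w\<close> into
        a difference \<open>d\<close> of the family; the offset \<open>x\<close> then moves the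
        block onto both points.\<close>
      obtain d where d: "[(int i + 1) * d = z - w] (mod p)" using solve[OF unit[OF u(2)]] by blast
      then have "\<not> p dvd d" using zw cong_dvd_iff[OF d] by auto
      then obtain r l m where r: "r \<in> R" "l < k" "m < k" "[d = r * (b l - b m)] (mod p)" using diff by blast
      define x where "x = (z - (int i + 1) * (r * b l)) mod p"
      have xz: "((int i + 1) * (r * b l) + x) mod p = z" unfolding x_def using u by (simp add: mod_add_right_eq)
      have "[(int i + 1) * (r * (b l - b m)) = z - w] (mod p)"
        using cong_trans[OF cong_sym[OF cong_scalar_left[OF r(4), of "int i + 1"]] d] .
      then have "[z - (int i + 1) * (r * (b l - b m)) = z - (z - w)] (mod p)"
        by (intro cong_diff cong_refl)
      moreover have "(z - (int i + 1) * (r * (b l - b m))) = (int i + 1) * (r * b m) + (z - (int i + 1) * (r * b l))"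
        by (simp add: algebra_simps)
      ultimately have "((int i + 1) * (r * b m) + x) mod p = w"
        unfolding x_def using v by (simp add: cong_def mod_add_right_eq)
      then have "v \<in> Q i r x" using v r True by (auto simp: Q_def)
      moreover have "u \<in> Q i r x" using u r xz by (auto simp: Q_def)
      moreover have "Q i r x \<in> F x" using u r by (auto simp: F_def)
      moreover have "F x \<in> set Hs" using p0 by (intro F_in) (simp add: x_def)
      ultimately show ?thesis by blast
    next
      case False
      have "\<not> p dvd int i - int j"
      proof
        assume "p dvd int i - int j"
        then have "p dvd \<bar>int i - int j\<bar>" by simp
        then have "p \<le> \<bar>int i - int j\<bar>" using False by (intro zdvd_imp_le) auto
        then show False using u v k by linarith
      qed
      then obtain y0 where "[(int i - int j) * y0 = z - w] (mod p)" using solve by blast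
      moreover define y where "y = y0 mod p"
      ultimately have y: "[(int i - int j) * y = z - w] (mod p)" by (simp add: cong_def mod_mult_right_eq)
      have y_rng: "y \<in> {0..<p}" using p0 by (simp add: y_def)
      define x where "x = (z - y * (int i + 1)) mod p"
      have x_rng: "x \<in> {0..<p}" using p0 by (simp add: x_def)
      have xz: "(y * (int i + 1) + x) mod p = z" unfolding x_def using u by (simp add: mod_add_right_eq)
      have "[z - (int i - int j) * y = z - (z - w)] (mod p)"
        using y by (intro cong_diff cong_refl)
      moreover have "z - (int i - int j) * y = y * (int j + 1) + (z - y * (int i + 1))"
        by (simp add: algebra_simps)
      ultimately have "(y * (int j + 1) + x) mod p = w"
        unfolding x_def using v by (simp add: cong_def mod_add_right_eq)
      then have B: "u \<in> line_block p k y x" "v \<in> line_block p k y x" using u v xz by (auto simp: mem_line_block)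
      show ?thesis
      proof (cases "y \<in> P")
        case True
        then show ?thesis using B E_in[OF True] x_rng by blast
      next
        case False
        then have "line_block p k y x \<in> F x" using y_rng by (auto simp: F_def)
        then show ?thesis using B F_in[OF x_rng] by blast
      qed
    qed
  qed
  have cover: "nsets V 2 \<subseteq> (\<Union>H\<in>set Hs. factor_edges H)"
  proof
    fix e assume e: "e \<in> nsets V 2"
    then obtain u v where uv: "e = {u, v}" "u \<noteq> v" "u \<in> V" "v \<in> V"
      by (auto simp: nsets_def card_2_iff)
    then obtain H B where HB: "H \<in> set Hs" "B \<in> H" "e \<subseteq> B" using covered[of u v] by blast
    then have "e \<in> nsets B 2" using e by (auto simp: nsets_def)
    then show "e \<in> (\<Union>H\<in>set Hs. factor_edges H)" using HB by (auto simp: factor_edges_def)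
  qed
  have "is_tournament k V Hs"
  proof (rule is_tournament_if_cover[OF finV _ cover])
    show "is_Kk_factor k V (nsets V 2) H" if "H \<in> set Hs" for H
      using that F E by (auto simp: Hs_def)
    \<comment> \<open>Equality holds: a player meets \<open>k - 1\<close> others in each round and
      all \<open>k * p - 1\<close> others in total.\<close>
    have "int (length Hs * (k - 1)) = int (card V - 1)"
    proof -
      have km: "int (k - 1) = int k - 1" using k by simp
      have "int (length Hs * (k - 1)) = p * (int k - 1) + int (card R * (k * (k - 1)))"
        unfolding len of_nat_mult of_nat_add km using p0 by (simp add: algebra_simps)
      also have "\<dots> = int k * p - 1" unfolding cardR by (simp add: algebra_simps)
      also have "\<dots> = int (card V) - 1" using p0 by (simp add: cardV)
      also have "\<dots> = int (card V - 1)" using p0 k by (simp add: cardV of_nat_diff Suc_le_eq)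
      finally show ?thesis .
    qed
    then show "length Hs * (k - 1) \<le> card V - 1" by linarith
  qed
  then show ?thesis using len cover unfolding V_def by blast
qed

section \<open>Non-extendable tournaments\<close>

lemma pair_cover_image:
  assumes T: "is_tournament k V Hs" and g: "inj_on g V"
    and cover: "nsets V 2 \<subseteq> (\<Union>H\<in>set Hs. factor_edges H)"
  shows "nsets (g ` V) 2 \<subseteq> (\<Union>H\<in>set (map ((`) ((`) g)) Hs). factor_edges H)"
proof -
  have "factor_edges ((`) g ` H) = (`) g ` factor_edges H" if "H \<in> set Hs" for H
  proof (rule factor_edges_image[OF _ g])
    show "B \<subseteq> V" if "B \<in> H" for B
      using T \<open>H \<in> set Hs\<close> that by (auto simp: is_tournament_def is_Kk_factor_def partition_on_def)
  qed
  then have "(\<Union>H\<in>set (map ((`) ((`) g)) Hs). factor_edges H) = (`) g ` (\<Union>H\<in>set Hs. factor_edges H)"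
    by (simp add: image_UN)
  then show ?thesis using cover unfolding nsets_image[OF g] by (metis image_mono)
qed

text \<open>Let \<open>q = (k - 1) * p - 1\<close>. For \<open>d \<le> k - 2\<close> the product
  \<open>s * d\<close> is positive and at most \<open>(r - 1) * (k - 2)\<close>, which is below
  \<open>q\<close>. For \<open>d = k - 1\<close> this can fail, but
  \<open>s * d * p = s * q + s\<close>, so \<open>q\<close> would divide \<open>s\<close>, and
  \<open>0 < s < q\<close>.\<close>

lemma shift_multiples_separated:
  fixes k p r s d :: int
  assumes k: "k \<ge> 3" and p: "p > 0" and r: "(k - 1) * r = k * p - 1"
    and d: "0 < d" "d < k" and s: "0 < s" "s < r"
  shows "\<not> ((k - 1) * p - 1) dvd s * d"
proof
  define q where "q = (k - 1) * p - 1"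
  assume "((k - 1) * p - 1) dvd s * d"
  then have dv: "q dvd s * d" by (simp add: q_def)
  have bound: "(r - 1) * (k - 2) < q"
  proof -
    have "(k - 1) * ((r - 1) * (k - 2)) = ((k - 1) * r - (k - 1)) * (k - 2)" by (simp add: algebra_simps)
    also have "\<dots> = k * (p - 1) * (k - 2)" unfolding r by (simp add: algebra_simps)
    also have "\<dots> = (k - 1) * q - (p + k * (k - 3) + 1)" by (simp add: q_def algebra_simps)
    also have "\<dots> < (k - 1) * q" using p mult_nonneg_nonneg[of k "k - 3"] k by linarith
    finally show ?thesis using k by (simp add: mult_less_cancel_left)
  qed
  have "r - 1 \<le> (r - 1) * (k - 2)" using k s mult_left_mono[of 1 "k - 2" "r - 1"] by simp
  then have rq: "s < q" using le_less_trans[OF _ bound, of "r - 1"] s by simp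
  show False
  proof (cases "d = k - 1")
    case True
    have "q dvd s * d * p" using dv by simp
    also have "s * d * p = s * q + s" by (simp add: True q_def algebra_simps)
    finally have "q dvd s" by simp
    then show False using zdvd_imp_le s rq by fastforce
  next
    case False
    then have "s * d \<le> (r - 1) * (k - 2)" using d s by (intro mult_mono) auto
    then have "s * d < q" using bound by linarith
    moreover have "s * d > 0" using s d by simp
    ultimately show False using zdvd_imp_le[OF dv] by linarith
  qed
qed

theorem theorem2:
  fixes k :: nat
  assumes "k \<ge> 3"
  shows "infinite {n :: nat. n > 0 \<and> k dvd n \<and>
           (\<exists>Hs. is_tournament k {..<n} Hs \<and>
                 length Hs = n div (k * (k - 1)) \<and>
                 \<not> can_be_extended k {..<n} Hs)}"
  unfolding infinite_nat_iff_unbounded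
proof
  fix N :: nat
  note k = assms
  obtain p0 where p0: "\<forall>p. prime p \<and> p \<ge> p0 \<and> k * (k - 1) dvd p - 1 \<longrightarrow>
    (\<exists>R b. disjoint_difference_family (int p) k R b)"
    using disjoint_difference_family_exists[OF k] by blast
  have "k * 2 \<le> k * (k - 1)" using k by (intro mult_le_mono2) simp
  then have "k * (k - 1) > 1" using k by linarith
  then obtain p where p: "prime p" "p > max (max N p0) k" "k * (k - 1) dvd p - 1"
    using prime_cong_1_above by blast
  have pN: "p > N" "p \<ge> p0" "p > k" using p(2) by auto
  obtain R b where Rb: "disjoint_difference_family (int p) k R b"
    using p0 p pN by blast
  define r where "r = p + k * card R"
  define A where "A = {..<k} \<times> {0..<int p}"
  obtain Ha where Ha: "is_tournament k A Ha" "length Ha = r" "nsets A 2 \<subseteq> (\<Union>H\<in>set Ha. factor_edges H)"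
    using resolvable_design_from_difference_family[OF _ _ _ Rb] p(1) pN k unfolding r_def A_def by auto
  have rk: "(int k - 1) * int r = int k * int p - 1"
  proof -
    have "int (card R * (k * (k - 1))) = int p - 1"
      using Rb by (simp add: disjoint_difference_family_def)
    moreover have "(int k - 1) * int r = (int k - 1) * int p + int (card R * (k * (k - 1)))"
      unfolding r_def using k by (simp add: of_nat_diff algebra_simps)
    ultimately show ?thesis by (simp add: algebra_simps)
  qed
  \<comment> \<open>The players outside the design number \<open>n - k * p = k * q\<close>, so they
    form \<open>k\<close> copies of the integers modulo \<open>q\<close>. This \<open>q\<close> can
    be composite, hence the separation condition \<open>sep\<close> below.\<close>
  define q where "q = (int k - 1) * int p - 1"
  define W where "W = {..<k} \<times> {0..<q}"
  define n where "n = k * (k * p - 1)"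
  have q0: "q > 0"
  proof -
    have "2 * 1 \<le> (int k - 1) * int p" using k p by (intro mult_mono) auto
    then show ?thesis by (simp add: q_def)
  qed
  have sep: "\<And>d s. 0 < d \<Longrightarrow> d < int k \<Longrightarrow> 0 < s \<Longrightarrow> s < int r \<Longrightarrow> \<not> q dvd s * d"
    unfolding q_def using k p rk by (intro shift_multiples_separated) auto
  obtain Hw where Hw: "is_tournament k W Hw" "length Hw = r"
    using parallel_lines_tournament[OF q0 _ sep, of k r] k unfolding W_def by fastforce
  have cardA: "card A = k * p" "finite A" by (simp_all add: A_def card_cartesian_product)
  have n_int: "int n = int k * (int k * int p - 1)" unfolding n_def using k p by (simp add: of_nat_diff Suc_le_eq)
  have cardW: "card W = n - k * p" "finite W" "k * p \<le> n"
  proof -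
    have "int n = int (card W) + int (k * p)"
      using q0 n_int by (simp add: W_def card_cartesian_product q_def algebra_simps)
    then have "n = card W + k * p" by linarith
    then show "card W = n - k * p" "k * p \<le> n" by auto
  qed (simp add: W_def)
  \<comment> \<open>The design is moved to the first \<open>k * p\<close> players, the parallel
    lines to the remaining ones.\<close>
  obtain g where g: "bij_betw g A {..<k * p}"
    using finite_same_card_bij[OF cardA(2), of "{..<k * p}"] cardA by auto
  obtain h where h: "bij_betw h W {k * p..<n}"
    using finite_same_card_bij[OF cardW(2), of "{k * p..<n}"] cardW by auto
  define Ga where "Ga = map ((`) ((`) g)) Ha"
  define Gw where "Gw = map ((`) ((`) h)) Hw"
  define Hs where "Hs = map2 (\<union>) Ga Gw"
  have Ga: "is_tournament k {..<k * p} Ga" "nsets {..<k * p} 2 \<subseteq> (\<Union>H\<in>set Ga. factor_edges H)"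
    using is_tournament_image[OF Ha(1), of g] pair_cover_image[OF Ha(1) _ Ha(3), of g] g
    by (auto simp: bij_betw_def Ga_def)
  have Gw: "is_tournament k {k * p..<n} Gw"
    using is_tournament_image[OF Hw(1), of h] h by (auto simp: bij_betw_def Gw_def)
  have len: "length Ga = r" "length Gw = r" by (simp_all add: Ga_def Gw_def Ha Hw)
  have "{..<k * p} \<union> {k * p..<n} = {..<n}" using cardW(3) by auto
  moreover have "is_tournament k ({..<k * p} \<union> {k * p..<n}) Hs"
    unfolding Hs_def using len by (intro is_tournament_Un Ga Gw) auto
  ultimately have tour: "is_tournament k {..<n} Hs" by simp
  have "(\<Union>H\<in>set Ga. factor_edges H) \<subseteq> (\<Union>H\<in>set Hs. factor_edges H)"
  proof
    fix e assume "e \<in> (\<Union>H\<in>set Ga. factor_edges H)"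
    then obtain i where i: "i < r" "e \<in> factor_edges (Ga ! i)" using len by (auto simp: in_set_conv_nth)
    then have "e \<in> factor_edges (Hs ! i)" using len by (auto simp: Hs_def factor_edges_def)
    moreover have "Hs ! i \<in> set Hs" using i len by (intro nth_mem) (simp add: Hs_def)
    ultimately show "e \<in> (\<Union>H\<in>set Hs. factor_edges H)" by blast
  qed
  then have cover: "nsets {..<k * p} 2 \<subseteq> (\<Union>H\<in>set Hs. factor_edges H)" using Ga(2) by blast
  have "n < k * p * k"
  proof -
    have "int n < int (k * p * k)" unfolding n_int using k by (simp add: algebra_simps)
    then show ?thesis by linarith
  qed
  then have "\<not> can_be_extended k {..<n} Hs"
    using k cardW(3) by (intro not_extendable_if_clique[OF _ _ _ cover]) auto
  moreover have "length Hs = n div (k * (k - 1))"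
  proof -
    \<comment> \<open>By \<open>rk\<close> the division is exact, so the floor loses
      nothing.\<close>
    have "int n = int (k * (k - 1) * r)" using n_int rk k by (simp add: of_nat_diff mult.assoc)
    then have "n = k * (k - 1) * r" by linarith
    then show ?thesis using k len by (simp add: Hs_def)
  qed
  moreover have "k dvd n" by (simp add: n_def)
  moreover have "n > N"
  proof -
    have "1 * p \<le> k * p" using k by (intro mult_right_mono) auto
    then show ?thesis using p cardW(3) by linarith
  qed
  ultimately show "\<exists>n>N. n \<in> {n. n > 0 \<and> k dvd n \<and>
           (\<exists>Hs. is_tournament k {..<n} Hs \<and>
                 length Hs = n div (k * (k - 1)) \<and>
                 \<not> can_be_extended k {..<n} Hs)}"
    using tour by (intro exI[of _ n]) auto
qed

end
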